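(* Let $\{S_i\}_{i\in\mathcal I}$ be a finite family of contracting similarities of $\mathbb{R}^d$, $S_i(x)=c_iM_i(x)+b_i$, let $C\subset\mathbb{R}^d$ be non-empty and compact, and let $F_C$ be the inhomogeneous attractor. With $s,\alpha,\beta,\gamma$ as in the context, \[ \overline{\dim}_{\mathrm B}F_C\le\max_{0\le x\le1}\min\Big\{xs+(1-x)\beta,\ x\alpha+(1-x)d,\ \alpha+(1-x)(\beta+d-1),\ \alpha+x\gamma+(1-x)\beta\Big\}. \]
   Context: Here $c_i\in(0,1)$, $M_i$ orthogonal, $b_i\in\mathbb{R}^d$; $T_i(x)=c_iM_i(x)$. $F_C$ is the unique non-empty compact set with $F_C=\bigcup_iS_i(F_C)\cup C$, and $F_\emptyset$ the unique non-empty compact set with $F_\emptyset=\bigcup_iS_i(F_\emptyset)$. $\mathcal I^*$ is the set of finite non-empty words over $\mathcal I$; $T_I$ and $c_I$ denote compositions and products along a word; $\mathcal I_k=\{I\in\mathcal I^*:2^{-k-1}<c_I\le2^{-k}\}$. $s$ is the unique $s\ge0$ with $\sum_ic_i^s=1$; $\alpha=\dim_{\mathrm H}F_\emptyset$; $\beta=\overline{\dim}_{\mathrm B}C$; $\gamma\ge0$ is defined by $\limsup_{k\to\infty}|\{T_I:I\in\mathcal I_k\}|^{1/k}=2^\gamma$. $\overline{\dim}_{\mathrm B}$ is upper box dimension. *)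

theory Defs
  imports "HOL-Analysis.Analysis"
begin

definition covering_number :: "'a::metric_space set \<Rightarrow> real \<Rightarrow> nat" where
  "covering_number F \<delta> =
     (LEAST n. \<exists>A. finite A \<and> card A = n \<and> F \<subseteq> \<Union>A \<and> (\<forall>U\<in>A. bounded U \<and> diameter U \<le> \<delta>))"

definition upper_box_dim :: "'a::metric_space set \<Rightarrow> ereal" where
  "upper_box_dim F =
     Limsup (at_right 0) (\<lambda>\<delta>. ereal (ln (real (covering_number F \<delta>)) / - ln \<delta>))"

definition hausdorff_measure :: "real \<Rightarrow> 'a::metric_space set \<Rightarrow> ennreal" where
  "hausdorff_measure s F =
     (SUP \<delta>\<in>{0<..}. INF U\<in>{U::nat \<Rightarrow> 'a set. F \<subseteq> (\<Union>i. U i) \<and> (\<forall>i. bounded (U i) \<and> diameter (U i) \<le> \<delta>)}.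
        (\<Sum>i. ennreal (diameter (U i) powr s)))"

definition hausdorff_dim :: "'a::metric_space set \<Rightarrow> real" where
  "hausdorff_dim F = Inf {s. 0 < s \<and> hausdorff_measure s F = 0}"

definition word_comp :: "('i \<Rightarrow> 'a \<Rightarrow> 'a) \<Rightarrow> 'i list \<Rightarrow> 'a \<Rightarrow> 'a" where
  "word_comp T w = foldr (\<lambda>i f. T i \<circ> f) w id"

definition word_ratio :: "('i \<Rightarrow> real) \<Rightarrow> 'i list \<Rightarrow> real" where
  "word_ratio c w = prod_list (map c w)"

definition words_k :: "'i set \<Rightarrow> ('i \<Rightarrow> real) \<Rightarrow> nat \<Rightarrow> 'i list set" where
  "words_k I c k = {w. w \<noteq> [] \<and> set w \<subseteq> I \<and>
      2 powr (- (real k + 1)) < word_ratio c w \<and> word_ratio c w \<le> 2 powr (- real k)}"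

end

(*
  Group the orbital sets S_w(C) according to the dyadic level k of the contraction ratio of w. Words
  with ratio below 2^(-n) only contribute points within O(2^(-n)) of F_0, so the covering number of
  F_C at scale 2^(-n) is at most a sum over the levels k <= n, and with x = k/n each term of the
  minimum bounds level k:
  - count words (Moran equation) and cover each S_w(C) at relative scale 2^(-(n-k));
  - level k lies within O(2^(-k)) of F_0; refine a cover of F_0 at scale 2^(-k) by small balls;
  - for p in F_0, S_w(y) = S_w(p) + T_w(y - p) exhibits level k as a subset of the Minkowski sum of
    F_0 and the union of the sets T_w(C - p). The latter is covered either by counting the maps T_w,
    or by noting that T_w(y - p) lies on a sphere whose radius takes only polynomially many values.
  The upper box dimension of F_0 is at most its Hausdorff dimension because many separated copies
  of F_0 at one scale generate a subset of large Hausdorff dimension.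
*)

theory Submission
  imports Defs
begin

section \<open>Covering by balls\<close>

text \<open>No separation of the copies is assumed, so different words may give overlapping or equal
  sets and \<open>s\<close> may exceed \<alpha>. Counting words is then wasteful, and the last three
  bounds replace the sum over words by a single cover of \<open>F0\<close>. Such a cover lives at
  one scale, whereas \<alpha> is a Hausdorff dimension and allows sets of all sizes; this is why the
  comparison of the two dimensions for \<open>F0\<close> is needed, and it has to tolerate overlaps.
  Two requirements shape the estimates. Constants must not depend on k or n, since k runs up to n;
  hence covering bounds are stated for all radii in (0, 1] and not only for small ones. And each of
  \<alpha>, \<beta>, \<gamma> and \<open>s\<close> is only approached up to some e > 0; a level
  loses at most 2 e in the exponent, the number of levels costs a third e, and e is arbitrary at the
  end. The cheapest of the four bounds is chosen for each level separately, and the worst level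
  decides. Therefore the minimum stands inside the supremum over x.\<close>

text \<open>A predicate with a real upper bound, in place of a least number, lets bounds such as
  \<open>K * r powr (- t)\<close> be added and multiplied without rounding. Centres may lie outside
  \<open>F\<close>.\<close>

definition cov :: "'a::metric_space set \<Rightarrow> real \<Rightarrow> real \<Rightarrow> bool" where
  "cov F r N \<longleftrightarrow> (\<exists>P. finite P \<and> real (card P) \<le> N \<and> F \<subseteq> (\<Union>p\<in>P. cball p r))"

lemma cov_nonneg: "cov F r N \<Longrightarrow> 0 \<le> N"
  unfolding cov_def using of_nat_0_le_iff order_trans by blast

lemma cov_mono:
  assumes "cov F r N" "G \<subseteq> F" "r \<le> r'" "N \<le> N'"
  shows "cov G r' N'"
proof -
  obtain P where "finite P" "real (card P) \<le> N" "F \<subseteq> (\<Union>p\<in>P. cball p r)"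
    using assms(1) unfolding cov_def by blast
  moreover have "(\<Union>p\<in>P. cball p r) \<subseteq> (\<Union>p\<in>P. cball p r')"
    using assms(3) by (intro UN_mono) (auto simp: subset_cball)
  ultimately show ?thesis
    unfolding cov_def using assms(2,4) by (intro exI[of _ P]) (auto 0 4)
qed

lemma cov_UN:
  assumes "finite A" and "\<And>a. a \<in> A \<Longrightarrow> cov (F a) r (N a)"
  shows "cov (\<Union>a\<in>A. F a) r (\<Sum>a\<in>A. N a)"
proof -
  have "\<forall>a\<in>A. \<exists>P. finite P \<and> real (card P) \<le> N a \<and> F a \<subseteq> (\<Union>p\<in>P. cball p r)"
    using assms(2) unfolding cov_def by blast
  then obtain P where P: "\<forall>a\<in>A. finite (P a) \<and> real (card (P a)) \<le> N a \<and> F a \<subseteq> (\<Union>p\<in>P a. cball p r)"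
    by metis
  have "real (card (\<Union>a\<in>A. P a)) \<le> (\<Sum>a\<in>A. real (card (P a)))"
    using card_UN_le[OF assms(1), of P] by (metis of_nat_le_iff of_nat_sum)
  also have "\<dots> \<le> (\<Sum>a\<in>A. N a)" using P by (intro sum_mono) auto
  finally show ?thesis
    unfolding cov_def using P assms(1) by (intro exI[of _ "\<Union>a\<in>A. P a"]) fastforce
qed

lemma cov_UN_const:
  assumes "finite A" and "\<And>a. a \<in> A \<Longrightarrow> cov (F a) r N" and "real (card A) \<le> B" and "0 \<le> N"
  shows "cov (\<Union>a\<in>A. F a) r (B * N)"
proof -
  have "cov (\<Union>a\<in>A. F a) r (\<Sum>a\<in>A. N)" using assms by (intro cov_UN) auto
  thus ?thesis using assms(3,4) by (elim cov_mono) (auto intro: mult_right_mono)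
qed

lemma cov_Un:
  assumes "cov F r N" "cov G r N'"
  shows "cov (F \<union> G) r (N + N')"
proof -
  have "cov (\<Union>b\<in>UNIV. if b then F else G) r (\<Sum>b\<in>UNIV. if b then N else N')"
    using assms by (intro cov_UN) auto
  thus ?thesis by (simp add: UNIV_bool Un_commute add.commute)
qed

lemma cov_refine:
  fixes F :: "'a::metric_space set"
  assumes "cov F R N" and "\<And>x::'a. cov (cball x R) r K"
  shows "cov F r (N * K)"
proof -
  obtain P where P: "finite P" "real (card P) \<le> N" "F \<subseteq> (\<Union>p\<in>P. cball p R)"
    using assms(1) unfolding cov_def by blast
  have "cov (\<Union>p\<in>P. cball p R) r (N * K)"
    using P cov_nonneg[OF assms(2)] by (intro cov_UN_const assms(2)) auto
  thus ?thesis using P(3) by (elim cov_mono) auto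
qed

lemma cov_nbhd:
  assumes "cov F r N" and "\<And>x. x \<in> G \<Longrightarrow> \<exists>y\<in>F. dist x y \<le> r'"
  shows "cov G (r + r') N"
proof -
  obtain P where P: "finite P" "real (card P) \<le> N" "F \<subseteq> (\<Union>p\<in>P. cball p r)"
    using assms(1) unfolding cov_def by blast
  have "G \<subseteq> (\<Union>p\<in>P. cball p (r + r'))"
  proof
    fix x assume "x \<in> G"
    then obtain y where y: "y \<in> F" "dist x y \<le> r'" using assms(2) by blast
    then obtain p where p: "p \<in> P" "dist p y \<le> r" using P(3) by auto
    have "dist p x \<le> r + r'" using p(2) y(2) dist_triangle[of p x y] by (simp add: dist_commute)
    thus "x \<in> (\<Union>p\<in>P. cball p (r + r'))" using p(1) by auto
  qed
  thus ?thesis using P unfolding cov_def by blast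
qed

lemma cov_Minkowski:
  fixes A B :: "'a::real_normed_vector set"
  assumes "cov A r N" "cov B r' N'"
  shows "cov {a + b | a b. a \<in> A \<and> b \<in> B} (r + r') (N * N')"
proof -
  obtain P where P: "finite P" "real (card P) \<le> N" "A \<subseteq> (\<Union>p\<in>P. cball p r)"
    using assms(1) unfolding cov_def by blast
  obtain Q where Q: "finite Q" "real (card Q) \<le> N'" "B \<subseteq> (\<Union>p\<in>Q. cball p r')"
    using assms(2) unfolding cov_def by blast
  let ?R = "(\<lambda>(p,q). p + q) ` (P \<times> Q)"
  have "card ?R \<le> card P * card Q"
    using card_image_le[of "P \<times> Q"] P(1) Q(1) by (simp add: card_cartesian_product)
  hence "real (card ?R) \<le> real (card P) * real (card Q)"
    by (metis of_nat_le_iff of_nat_mult)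
  also have "\<dots> \<le> N * N'" using P(2) Q(2) cov_nonneg[OF assms(1)] by (intro mult_mono) auto
  finally have "real (card ?R) \<le> N * N'" .
  moreover have "{a + b | a b. a \<in> A \<and> b \<in> B} \<subseteq> (\<Union>p\<in>?R. cball p (r + r'))"
  proof clarify
    fix a b assume "a \<in> A" "b \<in> B"
    obtain p where p: "p \<in> P" "dist p a \<le> r" using \<open>a \<in> A\<close> P(3) by auto
    obtain q where q: "q \<in> Q" "dist q b \<le> r'" using \<open>b \<in> B\<close> Q(3) by auto
    have "dist (p + q) (a + b) \<le> r + r'"
      using dist_triangle_add[of p q a b] p(2) q(2) by linarith
    moreover have "p + q \<in> ?R" using p(1) q(1) by force
    ultimately show "a + b \<in> (\<Union>p\<in>?R. cball p (r + r'))" by (intro UN_I[of "p + q"]) auto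
  qed
  ultimately show ?thesis unfolding cov_def using P(1) Q(1) by (intro exI[of _ ?R]) auto
qed

lemma cov_lipschitz_image:
  assumes "cov F r N" and "\<And>x y. dist (g x) (g y) \<le> L * dist x y" and "0 \<le> L"
  shows "cov (g ` F) (L * r) N"
proof -
  obtain P where P: "finite P" "real (card P) \<le> N" "F \<subseteq> (\<Union>p\<in>P. cball p r)"
    using assms(1) unfolding cov_def by blast
  have "card (g ` P) \<le> card P" using P(1) by (rule card_image_le)
  hence "real (card (g ` P)) \<le> N" using P(2) by linarith
  moreover have "g ` F \<subseteq> (\<Union>p\<in>g ` P. cball p (L * r))"
  proof clarify
    fix x assume "x \<in> F"
    then obtain p where p: "p \<in> P" "dist p x \<le> r" using P(3) by auto
    have "dist (g p) (g x) \<le> L * r"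
      using assms(2)[of p x] mult_left_mono[OF p(2) assms(3)] by linarith
    thus "g x \<in> (\<Union>p\<in>g ` P. cball p (L * r))" using p(1) by auto
  qed
  ultimately show ?thesis unfolding cov_def using P(1) by (intro exI[of _ "g ` P"]) auto
qed

section \<open>Packing bounds from volume\<close>

text \<open>The bound \<open>N\<close> makes a largest separated subset exist, and the balls around
  it cover \<open>E\<close>: an uncovered point could be added to it.\<close>

lemma cov_of_separated_bound:
  assumes "0 \<le> r"
    and "\<And>P. finite P \<Longrightarrow> P \<subseteq> E \<Longrightarrow> (\<forall>x\<in>P. \<forall>y\<in>P. x \<noteq> y \<longrightarrow> r < dist x y) \<Longrightarrow> real (card P) \<le> N"
  shows "cov E r N"
proof -
  define S where "S P \<longleftrightarrow> finite P \<and> P \<subseteq> E \<and> (\<forall>x\<in>P. \<forall>y\<in>P. x \<noteq> y \<longrightarrow> r < dist x y)" for P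
  have bd: "real (card P) \<le> N" if "S P" for P
    using that unfolding S_def by (intro assms(2)) simp_all
  have "\<exists>P. S P \<and> (\<forall>Q. S Q \<longrightarrow> card Q \<le> card P)"
  proof (rule ex_has_greatest_nat[where k = "{}" and b = "Suc (nat \<lceil>N\<rceil>)"])
    show "S {}" by (simp add: S_def)
    show "\<forall>P. S P \<longrightarrow> card P < Suc (nat \<lceil>N\<rceil>)"
    proof (intro allI impI)
      fix P assume "S P"
      from bd[OF this] show "card P < Suc (nat \<lceil>N\<rceil>)" by linarith
    qed
  qed
  then obtain P where P: "S P" and mx: "\<And>Q. S Q \<Longrightarrow> card Q \<le> card P"
    by blast
  have fin: "finite P" using P by (simp add: S_def)
  have "E \<subseteq> (\<Union>p\<in>P. cball p r)"
  proof
    fix x assume x: "x \<in> E"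
    show "x \<in> (\<Union>p\<in>P. cball p r)"
    proof (rule ccontr)
      assume "x \<notin> (\<Union>p\<in>P. cball p r)"
      hence far: "\<forall>p\<in>P. r < dist p x" by (auto simp: not_le)
      have "x \<notin> P" using bspec[OF far, of x] assms(1) by auto
      moreover have "S (insert x P)" using P x far by (auto simp: S_def dist_commute)
      ultimately show False using fin mx[of "insert x P"] by simp
    qed
  qed
  with fin bd[OF P] show ?thesis unfolding cov_def by blast
qed

text \<open>The balls of radius \<open>r / 2\<close> about the points are disjoint and lie between
  the spheres of radii \<open>a\<close> and \<open>b\<close>; comparing volumes, the volume of the
  unit ball cancels. The alternative with \<open>a = 0\<close> drops the inner boundary, as is
  needed for full balls and for very small spheres.\<close>

lemma card_separated_annulus:
  fixes P :: "'a::euclidean_space set"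
  assumes "finite P" and r: "0 < r" and ab: "0 \<le> a" "a \<le> b"
    and sep: "\<forall>x\<in>P. \<forall>y\<in>P. x \<noteq> y \<longrightarrow> r < dist x y"
    and P: "\<And>x. x \<in> P \<Longrightarrow> a + r / 2 \<le> dist z x \<and> dist z x \<le> b - r / 2 \<or> a = 0 \<and> dist z x \<le> b - r / 2"
  shows "real (card P) * (r / 2) ^ DIM('a) \<le> b ^ DIM('a) - a ^ DIM('a)"
proof -
  let ?\<mu> = "measure (lebesgue :: 'a measure)"
  let ?U = "\<Union>x\<in>P. ball x (r / 2)"
  have disj: "ball x (r / 2) \<inter> ball y (r / 2) = {}" if "x \<in> P" "y \<in> P" "x \<noteq> y" for x y
    using sep that by (intro disjoint_ballI) fastforce
  have fm: "?U \<in> lmeasurable" using assms(1) by (intro fmeasurable.finite_UN) auto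
  have "?\<mu> ?U = (\<Sum>x\<in>P. ?\<mu> (ball x (r / 2)))"
    using assms(1) disj by (intro measure_UNION') (auto simp: pairwise_def disjnt_def)
  also have "\<dots> = real (card P) * (unit_ball_vol DIM('a) * (r / 2) ^ DIM('a))"
    using r by (simp add: content_ball)
  finally have U: "?\<mu> ?U = real (card P) * (unit_ball_vol DIM('a) * (r / 2) ^ DIM('a))" .
  have inner: "ball z a \<inter> ?U = {}"
  proof -
    have False if "x \<in> P" "dist z y < a" "dist x y < r / 2" for x y
      using P[OF that(1)] that(2,3) dist_triangle[of z x y] zero_le_dist[of z y]
      by (auto simp: dist_commute)
    thus ?thesis by auto
  qed
  have "ball z a \<union> ?U \<subseteq> ball z b"
  proof -
    have "dist z y < b" if "x \<in> P" "dist x y < r / 2" for x y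
      using P[OF that(1)] that(2) dist_triangle[of z y x] by (auto simp: dist_commute)
    thus ?thesis using ab by auto
  qed
  hence "?\<mu> (ball z a \<union> ?U) \<le> ?\<mu> (ball z b)"
    using fm by (intro measure_mono_fmeasurable) auto
  moreover have "?\<mu> (ball z a \<union> ?U) = ?\<mu> (ball z a) + ?\<mu> ?U"
    using fm inner by (subst measure_Un3) auto
  ultimately have "?\<mu> (ball z a) + ?\<mu> ?U \<le> ?\<mu> (ball z b)" by simp
  hence "unit_ball_vol DIM('a) * (a ^ DIM('a) + real (card P) * (r / 2) ^ DIM('a))
      \<le> unit_ball_vol DIM('a) * b ^ DIM('a)"
    unfolding U using ab by (simp add: content_ball algebra_simps)
  hence "a ^ DIM('a) + real (card P) * (r / 2) ^ DIM('a) \<le> b ^ DIM('a)"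
    by simp
  thus ?thesis by simp
qed

text \<open>The bound is the volume ratio of balls of radii \<open>R + r / 2\<close> and
  \<open>r / 2\<close>.\<close>

lemma cov_cball:
  fixes x :: "'a::euclidean_space"
  assumes "0 \<le> R" "0 < r"
  shows "cov (cball x R) r ((1 + 2 * R / r) ^ DIM('a))"
proof (rule cov_of_separated_bound)
  fix P assume P: "finite P" "P \<subseteq> cball x R" "\<forall>x\<in>P. \<forall>y\<in>P. x \<noteq> y \<longrightarrow> r < dist x y"
  have *: "R + r / 2 = (1 + 2 * R / r) * (r / 2)" using assms by (simp add: field_simps)
  have "real (card P) * (r / 2) ^ DIM('a) \<le> (R + r / 2) ^ DIM('a) - 0 ^ DIM('a)"
    using P assms by (intro card_separated_annulus[where z = x]) auto
  also have "(R + r / 2) ^ DIM('a) - 0 ^ DIM('a) = (1 + 2 * R / r) ^ DIM('a) * (r / 2) ^ DIM('a)"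
    unfolding * power_mult_distrib by simp
  finally show "real (card P) \<le> (1 + 2 * R / r) ^ DIM('a)"
    using assms by simp
qed (use assms in simp)

lemma bounded_imp_cov:
  fixes F :: "'a::euclidean_space set"
  assumes "bounded F" "0 < r"
  shows "\<exists>N. cov F r N"
proof -
  obtain R where R: "0 < R" "F \<subseteq> ball 0 R" using bounded_subset_ballD[OF assms(1)] by blast
  have "cov F r ((1 + 2 * R / r) ^ DIM('a))"
    using R assms(2) ball_subset_cball by (intro cov_mono[OF cov_cball[of R r 0]]) auto
  thus ?thesis by blast
qed

lemma power_diff_le:
  fixes a b :: real
  assumes "0 \<le> a" "a \<le> b"
  shows "b ^ n - a ^ n \<le> real n * (b - a) * b ^ (n - 1)"
proof -
  have "b ^ n - a ^ n = (b - a) * (\<Sum>i<n. a ^ (n - Suc i) * b ^ i)"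
    by (rule power_diff_sumr2)
  also have "\<dots> \<le> (b - a) * (\<Sum>i<n. b ^ (n - 1))"
  proof (intro mult_left_mono sum_mono)
    fix i assume "i \<in> {..<n}"
    hence "b ^ (n - 1) = b ^ (n - Suc i) * b ^ i" by (simp flip: power_add)
    thus "a ^ (n - Suc i) * b ^ i \<le> b ^ (n - 1)"
      using assms by (auto intro!: mult_right_mono power_mono)
  qed (use assms in auto)
  finally show ?thesis by (simp add: mult_ac)
qed

text \<open>The small balls fill an annulus of thickness at most \<open>r\<close>, so its volume
  gains one factor \<open>r\<close> and only the power \<open>DIM('a) - 1\<close> of
  \<open>R / r\<close> remains. The summand 1 keeps the bound valid for radii below
  \<open>r\<close>.\<close>

lemma cov_sphere:
  fixes z :: "'a::euclidean_space"
  assumes "0 \<le> R" "0 < r"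
  shows "cov (sphere z R) r (2 ^ DIM('a) * real DIM('a) * (1 + R / r) ^ (DIM('a) - 1))"
proof (rule cov_of_separated_bound)
  let ?d = "DIM('a)"
  fix P assume P: "finite P" "P \<subseteq> sphere z R" "\<forall>x\<in>P. \<forall>y\<in>P. x \<noteq> y \<longrightarrow> r < dist x y"
  \<comment> \<open>The truncation at 0 treats spheres of radius below \<open>r / 2\<close>, whose
    annulus is a full ball.\<close>
  define a where "a = max 0 (R - r / 2)"
  define b where "b = R + r / 2"
  have ab: "0 \<le> a" "a \<le> b" "b - a \<le> r" "b \<le> R + r"
    using assms by (auto simp: a_def b_def)
  have "real (card P) * (r / 2) ^ ?d \<le> b ^ ?d - a ^ ?d"
    using P assms ab by (intro card_separated_annulus[where z = z]) (auto simp: a_def b_def max_def)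
  also have "\<dots> \<le> real ?d * (b - a) * b ^ (?d - 1)" using ab by (intro power_diff_le)
  also have "\<dots> \<le> real ?d * r * (R + r) ^ (?d - 1)"
    using ab assms by (intro mult_mono power_mono) auto
  also have "R + r = (1 + R / r) * r" using assms by (simp add: field_simps)
  also have "((1 + R / r) * r) ^ (?d - 1) = (1 + R / r) ^ (?d - 1) * r ^ (?d - 1)"
    by (rule power_mult_distrib)
  also have "real ?d * r * ((1 + R / r) ^ (?d - 1) * r ^ (?d - 1))
      = real ?d * (1 + R / r) ^ (?d - 1) * (r * r ^ (?d - 1))" by simp
  also have "r * r ^ (?d - 1) = r ^ ?d" by (simp flip: power_Suc)
  also have "r ^ ?d = 2 ^ ?d * (r / 2) ^ ?d" by (simp flip: power_mult_distrib)
  also have "real ?d * (1 + R / r) ^ (?d - 1) * (2 ^ ?d * (r / 2) ^ ?d)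
    = (2 ^ ?d * real ?d * (1 + R / r) ^ (?d - 1)) * (r / 2) ^ ?d" by simp
  finally show "real (card P) \<le> 2 ^ ?d * real ?d * (1 + R / r) ^ (?d - 1)"
    using assms by simp
qed (use assms in simp)

text \<open>Constant factors in the radius cost only constant factors in the count, so later
  estimates may be made at any fixed multiple of the intended scale.\<close>

lemma cov_rescale:
  fixes F :: "'a::euclidean_space set"
  assumes "cov F (L * r) N" "0 < r" "0 \<le> L"
  shows "cov F r (N * (1 + 2 * L) ^ DIM('a))"
  using assms(1)
proof (rule cov_refine)
  show "cov (cball x (L * r)) r ((1 + 2 * L) ^ DIM('a))" for x :: 'a
    using cov_cball[of "L * r" r x] assms by (simp add: field_simps)
qed

section \<open>Upper box dimension\<close>

lemma covering_number_le:
  fixes F :: "'a::euclidean_space set"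
  assumes "cov F r N" "0 \<le> r" "2 * r \<le> \<delta>"
  shows "real (covering_number F \<delta>) \<le> N"
proof -
  obtain P where P: "finite P" "real (card P) \<le> N" "F \<subseteq> (\<Union>p\<in>P. cball p r)"
    using assms(1) unfolding cov_def by blast
  define A where "A = (\<lambda>p. cball p r) ` P"
  have "finite A \<and> card A = card A \<and> F \<subseteq> \<Union>A \<and> (\<forall>U\<in>A. bounded U \<and> diameter U \<le> \<delta>)"
  proof (intro conjI ballI)
    fix U assume "U \<in> A"
    then obtain p where U: "U = cball p r" by (auto simp: A_def)
    show "bounded U" by (simp add: U)
    show "diameter U \<le> \<delta>" using assms(2,3) by (simp add: U)
  qed (use P in \<open>auto simp: A_def\<close>)
  hence "covering_number F \<delta> \<le> card A"
    unfolding covering_number_def by (intro Least_le) blast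
  also have "card A \<le> card P" unfolding A_def using P(1) by (rule card_image_le)
  finally show ?thesis using P(2) by linarith
qed

lemma cov_covering_number:
  fixes F :: "'a::euclidean_space set"
  assumes "bounded F" "0 < \<delta>"
  shows "cov F \<delta> (real (covering_number F \<delta>))"
proof -
  let ?Q = "\<lambda>n. \<exists>A. finite A \<and> card A = n \<and> F \<subseteq> \<Union>A \<and> (\<forall>U\<in>A. bounded U \<and> diameter U \<le> \<delta>)"
  obtain N where "cov F (\<delta> / 2) N" using bounded_imp_cov[OF assms(1), of "\<delta> / 2"] assms(2) by auto
  then obtain P where P: "finite P" "F \<subseteq> (\<Union>p\<in>P. cball p (\<delta> / 2))"
    unfolding cov_def by blast
  \<comment> \<open>The \<open>LEAST\<close> in \<open>covering_number\<close> carries information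
    only once some finite cover is exhibited.\<close>
  have "?Q (card ((\<lambda>p. cball p (\<delta> / 2)) ` P))"
    using P assms(2) by (intro exI[of _ "(\<lambda>p. cball p (\<delta> / 2)) ` P"]) auto
  hence "?Q (covering_number F \<delta>)" unfolding covering_number_def by (rule LeastI)
  then obtain A where A: "finite A" "card A = covering_number F \<delta>" "F \<subseteq> \<Union>A"
      and diam: "\<And>U. U \<in> A \<Longrightarrow> bounded U \<and> diameter U \<le> \<delta>"
    by blast
  \<comment> \<open>One point of each set serves as centre. An empty set yields an arbitrary centre,
    which does no harm.\<close>
  define P where "P = (\<lambda>U. SOME x. x \<in> U) ` A"
  have "F \<subseteq> (\<Union>p\<in>P. cball p \<delta>)"
  proof
    fix x assume "x \<in> F"
    then obtain U where U: "U \<in> A" "x \<in> U" using A(3) by blast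
    have "(SOME x. x \<in> U) \<in> U" using U(2) by (rule someI)
    hence "dist (SOME x. x \<in> U) x \<le> diameter U"
      using U diam by (intro diameter_bounded_bound) auto
    hence "dist (SOME x. x \<in> U) x \<le> \<delta>" using diam[OF U(1)] by linarith
    thus "x \<in> (\<Union>p\<in>P. cball p \<delta>)" using U(1) by (auto simp: P_def)
  qed
  moreover have "real (card P) \<le> real (covering_number F \<delta>)"
    unfolding P_def A(2)[symmetric] of_nat_le_iff using A(1) by (rule card_image_le)
  ultimately show ?thesis unfolding cov_def using A(1) by (intro exI[of _ P]) (auto simp: P_def)
qed

lemma covering_number_ge_1:
  fixes F :: "'a::euclidean_space set"
  assumes "bounded F" "F \<noteq> {}" "0 < \<delta>"
  shows "1 \<le> real (covering_number F \<delta>)"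
proof (rule ccontr)
  assume "\<not> 1 \<le> real (covering_number F \<delta>)"
  hence "covering_number F \<delta> = 0" by linarith
  with cov_covering_number[OF assms(1,3)] obtain P :: "'a set"
    where "finite P" "card P = 0" "F \<subseteq> (\<Union>p\<in>P. cball p \<delta>)"
    unfolding cov_def by auto
  thus False using assms(2) by auto
qed

lemma ex_power2_near:
  assumes "0 < (r::real)" "r \<le> 1"
  shows "\<exists>n::nat. 2 powr (- real n) \<le> r \<and> 2 powr real n \<le> 2 / r"
proof -
  define n where "n = nat \<lceil>- log 2 r\<rceil>"
  have "log 2 r \<le> 0" using assms by simp
  hence n: "- log 2 r \<le> real n" "real n \<le> 1 - log 2 r" unfolding n_def by linarith+
  have "2 powr (- real n) \<le> 2 powr (log 2 r)" using n by (intro powr_mono) auto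
  moreover have "2 powr real n \<le> 2 powr (1 - log 2 r)" using n by (intro powr_mono) auto
  ultimately show ?thesis using assms by (intro exI[of _ n]) (simp add: powr_diff)
qed

text \<open>Dyadic radii suffice, because every scale is within a bounded factor of one of them;
  \<open>K\<close> and that factor disappear after division by \<open>- ln \<delta>\<close>.\<close>

lemma upper_box_dim_le_of_cov:
  fixes F :: "'a::euclidean_space set"
  assumes F: "bounded F" "F \<noteq> {}" and "0 \<le> t"
    and cov: "\<And>n. 1 \<le> n \<Longrightarrow> cov F (2 powr (- real n)) (K * 2 powr (real n * t))"
  shows "upper_box_dim F \<le> ereal t"
proof (rule ereal_le_epsilon2)
  fix e :: real assume e: "0 < e"
  \<comment> \<open>\<open>A\<close> dominates the part of the numerator that stays bounded as
    \<delta> tends to 0, and \<delta>0 is chosen to give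
    \<open>A \<le> e * - ln \<delta>\<close>.\<close>
  define A where "A = \<bar>ln (max K 1) + t * ln 4\<bar>"
  define \<delta>0 where "\<delta>0 = min (exp (- (A / e))) 1"
  have "0 < \<delta>0" by (simp add: \<delta>0_def)
  have "ln (real (covering_number F \<delta>)) / - ln \<delta> \<le> t + e" if \<delta>: "0 < \<delta>" "\<delta> < \<delta>0" for \<delta>
  proof -
    have \<delta>1: "\<delta> < 1" and "\<delta> < exp (- (A / e))" using \<delta> by (auto simp: \<delta>0_def)
    hence "ln \<delta> < - (A / e)" using \<delta>(1) by (metis exp_gt_zero ln_exp ln_less_cancel_iff)
    hence A: "A \<le> e * - ln \<delta>" using e by (simp add: field_simps)
    \<comment> \<open>Half of \<delta> is used because \<open>covering_number\<close> measures
      diameters and \<open>cov\<close> measures radii.\<close>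
    obtain n :: nat where n: "2 powr (- real n) \<le> \<delta> / 2" "2 powr real n \<le> 2 / (\<delta> / 2)"
      using ex_power2_near[of "\<delta> / 2"] \<delta>(1) \<delta>1 by auto
    have "n \<noteq> 0" using n(1) \<delta>1 by (intro notI) simp
    have "real (covering_number F \<delta>) \<le> K * 2 powr (real n * t)"
      using n(1) \<open>n \<noteq> 0\<close> by (intro covering_number_le[OF cov]) auto
    also have "\<dots> \<le> max K 1 * (4 / \<delta>) powr t"
    proof -
      have "2 powr (real n * t) = (2 powr real n) powr t" by (simp add: powr_powr)
      also have "\<dots> \<le> (4 / \<delta>) powr t" using n(2) assms(3) by (intro powr_mono2) auto
      finally show ?thesis by (intro mult_mono) auto
    qed
    finally have le: "real (covering_number F \<delta>) \<le> max K 1 * (4 / \<delta>) powr t" .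
    have "ln (real (covering_number F \<delta>)) \<le> ln (max K 1 * (4 / \<delta>) powr t)"
      using covering_number_ge_1[OF F \<delta>(1)] le by (intro ln_mono) auto
    also have "\<dots> = ln (max K 1) + ln ((4 / \<delta>) powr t)"
      using \<delta>(1) by (intro ln_mult_pos) auto
    also have "\<dots> = ln (max K 1) + t * (ln 4 - ln \<delta>)"
      using \<delta>(1) by (simp add: ln_powr ln_div)
    also have "\<dots> \<le> A + t * - ln \<delta>" by (simp add: A_def algebra_simps)
    also have "\<dots> \<le> (t + e) * - ln \<delta>" using A by (simp add: algebra_simps)
    finally show ?thesis using \<delta>(1) \<delta>1 by (subst pos_divide_le_eq) auto
  qed
  hence "\<forall>\<^sub>F \<delta> in at_right 0. ereal (ln (real (covering_number F \<delta>)) / - ln \<delta>) \<le> ereal (t + e)"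
    using \<open>0 < \<delta>0\<close> unfolding eventually_at_right_field by (intro exI[of _ \<delta>0]) auto
  thus "upper_box_dim F \<le> ereal t + ereal e"
    unfolding upper_box_dim_def by (simp add: Limsup_bounded)
qed

lemma upper_box_dim_nonneg:
  fixes F :: "'a::euclidean_space set"
  assumes "bounded F" "F \<noteq> {}"
  shows "0 \<le> upper_box_dim F"
proof -
  have "0 \<le> ln (real (covering_number F \<delta>)) / - ln \<delta>" if "0 < \<delta>" "\<delta> < 1" for \<delta>
    using covering_number_ge_1[OF assms that(1)] that by (intro divide_nonneg_pos) auto
  hence "\<forall>\<^sub>F \<delta> in at_right 0. 0 \<le> ereal (ln (real (covering_number F \<delta>)) / - ln \<delta>)"
    unfolding eventually_at_right_field by (intro exI[of _ 1]) auto
  thus ?thesis unfolding upper_box_dim_def by (intro le_Limsup) auto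
qed

text \<open>The upper limit controls only radii below some \<eta>. For the remaining ones a fixed
  cover at scale \<eta> is enough, since \<open>r powr (- t)\<close> is at least 1 there.\<close>

lemma cov_of_upper_box_dim:
  fixes F :: "'a::euclidean_space set"
  assumes F: "bounded F" "F \<noteq> {}" and t: "upper_box_dim F < ereal t"
  shows "\<exists>K>0. \<forall>r. 0 < r \<longrightarrow> r \<le> 1 \<longrightarrow> cov F r (K * r powr (- t))"
proof -
  have "0 \<le> t" using upper_box_dim_nonneg[OF F] t by (metis ereal_less_eq(5) less_imp_le order_trans)
  have "\<forall>\<^sub>F \<delta> in at_right 0. ereal (ln (real (covering_number F \<delta>)) / - ln \<delta>) < ereal t"
    using t unfolding upper_box_dim_def by (rule Limsup_lessD)
  then obtain \<delta>0 where \<delta>0: "0 < \<delta>0"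
      "\<And>\<delta>. 0 < \<delta> \<Longrightarrow> \<delta> < \<delta>0 \<Longrightarrow> ln (real (covering_number F \<delta>)) / - ln \<delta> < t"
    unfolding eventually_at_right_field by auto
  define \<eta> where "\<eta> = min \<delta>0 1 / 2"
  have \<eta>: "0 < \<eta>" "\<eta> < \<delta>0" "\<eta> < 1" using \<delta>0(1) by (auto simp: \<eta>_def min_def)
  obtain N where N: "cov F \<eta> N" using bounded_imp_cov[OF F(1) \<eta>(1)] by auto
  have "cov F r (max N 1 * r powr (- t))" if r: "0 < r" "r \<le> 1" for r
  proof (cases "r < \<eta>")
    case True
    have "ln (real (covering_number F r)) < t * - ln r"
      using \<delta>0(2)[of r] True r \<eta> by (simp add: field_simps)
    also have "\<dots> = ln (r powr (- t))" using r by (simp add: ln_powr)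
    finally have "real (covering_number F r) \<le> r powr (- t)"
      using covering_number_ge_1[OF F r(1)] r by (subst (asm) ln_less_cancel_iff) auto
    also have "\<dots> \<le> max N 1 * r powr (- t)" by (simp add: mult_le_cancel_right1)
    finally show ?thesis by (intro cov_mono[OF cov_covering_number[OF F(1) r(1)]]) auto
  next
    case False
    have "r powr t \<le> 1" using r \<open>0 \<le> t\<close> by (intro powr_le1) auto
    hence "1 \<le> r powr (- t)" using r by (simp add: powr_minus one_le_inverse_iff)
    hence "max N 1 * 1 \<le> max N 1 * r powr (- t)" by (intro mult_left_mono) auto
    thus ?thesis using False by (intro cov_mono[OF N]) auto
  qed
  thus ?thesis by (intro exI[of _ "max N 1"]) auto
qed

section \<open>Finite covers and Hausdorff dimension\<close>

text \<open>Some exponent below \<open>t\<close> has measure zero. Its covers with diameters at most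
  1 also work for \<open>t\<close>, because a larger exponent only decreases the terms. Hypothesis
  \<open>ne\<close> keeps the infimum in \<open>hausdorff_dim\<close> from being taken over the
  empty set.\<close>

lemma ex_countable_cover_of_hausdorff_dim:
  fixes F :: "'a::metric_space set"
  assumes ne: "\<exists>s. 0 < s \<and> hausdorff_measure s F = 0"
    and t: "hausdorff_dim F < t" and e: "0 < e"
  shows "\<exists>U::nat \<Rightarrow> 'a set. F \<subseteq> (\<Union>i. U i) \<and> (\<forall>i. bounded (U i)) \<and>
           (\<Sum>i. ennreal (diameter (U i) powr t)) < ennreal e"
proof -
  obtain s where s: "0 < s" "hausdorff_measure s F = 0" "s < t"
    using cInf_lessD[OF _ t[unfolded hausdorff_dim_def]] ne by auto
  let ?C = "\<lambda>\<delta>. {U::nat \<Rightarrow> 'a set. F \<subseteq> (\<Union>i. U i) \<and> (\<forall>i. bounded (U i) \<and> diameter (U i) \<le> \<delta>)}"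
  have "(INF U\<in>?C 1. \<Sum>i. ennreal (diameter (U i) powr s)) \<le> hausdorff_measure s F"
    unfolding hausdorff_measure_def by (rule SUP_upper) simp
  hence "(INF U\<in>?C 1. \<Sum>i. ennreal (diameter (U i) powr s)) < ennreal e" using s e by simp
  then obtain U where U: "U \<in> ?C 1" "(\<Sum>i. ennreal (diameter (U i) powr s)) < ennreal e"
    unfolding INF_less_iff by blast
  have "diameter (U i) powr t \<le> diameter (U i) powr s" for i
    using U(1) s by (intro powr_mono') (auto simp: diameter_ge_0)
  hence "(\<Sum>i. ennreal (diameter (U i) powr t)) \<le> (\<Sum>i. ennreal (diameter (U i) powr s))"
    by (intro suminf_le) (auto intro: ennreal_leI)
  thus ?thesis using U by (intro exI[of _ U]) auto
qed

text \<open>Continuity of the power at \<open>a\<close>, including \<open>a = 0\<close>. It prices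
  the enlargement of a covering set to an open one.\<close>

lemma powr_enlarge:
  fixes a t e :: real
  assumes "0 \<le> a" "0 < t" "0 < e"
  shows "\<exists>\<eta>>0. (a + 2 * \<eta>) powr t < a powr t + e"
proof -
  \<comment> \<open>\<open>y\<close> is the size whose power is exactly \<open>a powr t + e\<close>;
    a quarter of \<open>y - a\<close> then leaves room for 2 \<eta>.\<close>
  define y where "y = (a powr t + e) powr (1 / t)"
  have y: "y powr t = a powr t + e" using assms by (simp add: y_def powr_powr add_nonneg_pos)
  have "a < y"
  proof (rule ccontr)
    assume "\<not> a < y"
    hence "y powr t \<le> a powr t" using assms by (intro powr_mono2) (auto simp: y_def)
    thus False using y assms by simp
  qed
  hence "a + 2 * ((y - a) / 4) < y" by (simp add: field_simps)
  hence "(a + 2 * ((y - a) / 4)) powr t < y powr t"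
    using assms \<open>a < y\<close> by (intro powr_less_mono2) auto
  thus ?thesis using y \<open>a < y\<close> by (intro exI[of _ "(y - a) / 4"]) simp
qed

lemma diameter_thicken_le:
  fixes U :: "'a::euclidean_space set"
  assumes "bounded U" "0 \<le> \<eta>"
  shows "bounded (\<Union>u\<in>U. ball u \<eta>)" "diameter (\<Union>u\<in>U. ball u \<eta>) \<le> diameter U + 2 * \<eta>"
proof -
  have *: "dist x y \<le> diameter U + 2 * \<eta>"
    if xy: "x \<in> (\<Union>u\<in>U. ball u \<eta>)" "y \<in> (\<Union>u\<in>U. ball u \<eta>)" for x y
  proof -
    obtain u v where uv: "u \<in> U" "v \<in> U" "dist u x < \<eta>" "dist v y < \<eta>" using xy by auto
    have "dist u v \<le> diameter U" using assms(1) uv by (intro diameter_bounded_bound)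
    thus ?thesis using dist_triangle[of x y u] dist_triangle[of u y v] uv(3,4)
      by (simp add: dist_commute)
  qed
  show "bounded (\<Union>u\<in>U. ball u \<eta>)"
    unfolding bounded_two_points using * by blast
  show "diameter (\<Union>u\<in>U. ball u \<eta>) \<le> diameter U + 2 * \<eta>"
    using * diameter_ge_0[OF assms(1)] assms(2) by (intro diameter_le) (auto simp: dist_norm)
qed

text \<open>The sets are thickened to open ones, the i-th at a cost below
  \<open>e / 2 * (1 / 2) ^ Suc i\<close>, and compactness leaves finitely many. Finiteness is what
  permits an induction on the size of the cover.\<close>

lemma ex_finite_cover_of_hausdorff_dim:
  fixes F :: "'a::euclidean_space set"
  assumes "compact F" and ne: "\<exists>s. 0 < s \<and> hausdorff_measure s F = 0"
    and t: "hausdorff_dim F < t" "0 < t" and e: "0 < e"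
  shows "\<exists>(J::nat set) V. finite J \<and> (\<forall>j\<in>J. bounded (V j)) \<and> F \<subseteq> (\<Union>j\<in>J. V j) \<and>
           (\<Sum>j\<in>J. diameter (V j) powr t) < e"
proof -
  obtain U :: "nat \<Rightarrow> 'a set" where U: "F \<subseteq> (\<Union>i. U i)" "\<And>i. bounded (U i)"
      "(\<Sum>i. ennreal (diameter (U i) powr t)) < ennreal (e / 2)"
    using ex_countable_cover_of_hausdorff_dim[OF ne t(1) half_gt_zero[OF e]] by blast
  have "\<forall>i. \<exists>\<eta>>0. (diameter (U i) + 2 * \<eta>) powr t < diameter (U i) powr t + e / 2 * (1 / 2) ^ Suc i"
    using U(2) e t(2) by (intro allI powr_enlarge) (auto simp: diameter_ge_0)
  then obtain \<eta> where \<eta>: "\<And>i. 0 < \<eta> i"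
      "\<And>i. (diameter (U i) + 2 * \<eta> i) powr t < diameter (U i) powr t + e / 2 * (1 / 2) ^ Suc i"
    by metis
  define V where "V i = (\<Union>u\<in>U i. ball u (\<eta> i))" for i
  have V: "bounded (V i)" "diameter (V i) \<le> diameter (U i) + 2 * \<eta> i" for i
    unfolding V_def using diameter_thicken_le[OF U(2), of "\<eta> i" i] \<eta>(1)[of i] by auto
  have "U i \<subseteq> V i" for i using \<eta>(1)[of i] unfolding V_def by force
  hence "(\<Union>i. U i) \<subseteq> (\<Union>i. V i)" by (intro UN_mono) auto
  hence cover: "F \<subseteq> (\<Union>i\<in>UNIV. V i)" using U(1) by (rule order_trans[rotated])
  have "open (V i)" for i unfolding V_def by auto
  then obtain J where J: "finite J" "F \<subseteq> (\<Union>j\<in>J. V j)"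
    using compactE_image[OF assms(1) _ cover] by metis
  have "(\<Sum>j\<in>J. diameter (V j) powr t) \<le> (\<Sum>j\<in>J. diameter (U j) powr t + e / 2 * (1 / 2) ^ Suc j)"
  proof (intro sum_mono)
    fix j
    have "diameter (V j) powr t \<le> (diameter (U j) + 2 * \<eta> j) powr t"
      using V t(2) by (intro powr_mono2) (auto simp: diameter_ge_0)
    thus "diameter (V j) powr t \<le> diameter (U j) powr t + e / 2 * (1 / 2) ^ Suc j"
      using \<eta>(2)[of j] by linarith
  qed
  also have "\<dots> = (\<Sum>j\<in>J. diameter (U j) powr t) + e / 2 * (\<Sum>j\<in>J. (1 / 2) ^ Suc j)"
    by (simp add: sum.distrib sum_distrib_left)
  also have "(\<Sum>j\<in>J. (1 / 2) ^ Suc j) \<le> (1::real)"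
    using sum_le_suminf[OF sums_summable[OF power_half_series] J(1)] sums_unique[OF power_half_series]
    by simp
  also have "(\<Sum>j\<in>J. diameter (U j) powr t) < e / 2"
  proof -
    have "ennreal (\<Sum>j\<in>J. diameter (U j) powr t) = (\<Sum>j\<in>J. ennreal (diameter (U j) powr t))"
      by (simp add: sum_ennreal)
    also have "\<dots> \<le> (\<Sum>j. ennreal (diameter (U j) powr t))"
      using J(1) by (intro sum_le_suminf) auto
    also have "\<dots> < ennreal (e / 2)" by (rule U(3))
    finally show ?thesis by (subst (asm) ennreal_less_iff) (auto intro: sum_nonneg)
  qed
  finally have "(\<Sum>j\<in>J. diameter (V j) powr t) < e" using e by simp
  thus ?thesis using J V by blast
qed

text \<open>A cover by sets smaller than the gap splits into covers of the separate copies. Pulling the cheapest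
  of these back to \<open>F\<close> gives a cover of \<open>F\<close> by fewer sets without increasing the sum.\<close>

lemma diameter_sum_ge_of_separated_copies:
  fixes F :: "'a::euclidean_space set" and g :: "'w \<Rightarrow> 'a \<Rightarrow> 'a" and U :: "'j \<Rightarrow> 'a set"
  assumes W: "finite W" "2 \<le> card W" and \<rho>: "0 < \<rho>" "1 \<le> real (card W) * \<rho> powr t"
    and t: "0 < t" and \<eta>: "0 < \<eta>" and F: "F \<noteq> {}" "bounded F"
    and g: "\<And>w x. w \<in> W \<Longrightarrow> x \<in> F \<Longrightarrow> g w x \<in> F"
    and expand: "\<And>w x y. w \<in> W \<Longrightarrow> \<rho> * dist x y \<le> dist (g w x) (g w y)"
    and gap: "\<And>v w x y. v \<in> W \<Longrightarrow> w \<in> W \<Longrightarrow> v \<noteq> w \<Longrightarrow> x \<in> F \<Longrightarrow> y \<in> F \<Longrightarrow> \<eta> \<le> dist (g v x) (g w y)"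
    and "finite J" "\<And>j. j \<in> J \<Longrightarrow> bounded (U j)" "F \<subseteq> (\<Union>j\<in>J. U j)"
  shows "\<eta> powr t \<le> (\<Sum>j\<in>J. diameter (U j) powr t)"
  using assms(12-14)
proof (induction "card J" arbitrary: J U rule: less_induct)
  case less
  note finJ = less.prems(1) and bdU = less.prems(2) and FU = less.prems(3)
  let ?m = "real (card W)"
  show ?case
  proof (rule ccontr)
    let ?T = "\<Sum>j\<in>J. diameter (U j) powr t"
    assume "\<not> \<eta> powr t \<le> ?T"
    hence T: "?T < \<eta> powr t" by simp
    have small: "diameter (U j) < \<eta>" if "j \<in> J" for j
    proof (rule ccontr)
      assume "\<not> diameter (U j) < \<eta>"
      hence "\<eta> powr t \<le> diameter (U j) powr t" using t \<eta> by (intro powr_mono2) auto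
      also have "\<dots> \<le> ?T" using that finJ by (intro member_le_sum) auto
      finally show False using T by simp
    qed
    define Jw where "Jw w = {j\<in>J. U j \<inter> g w ` F \<noteq> {}}" for w
    have Jw_sub: "Jw w \<subseteq> J" for w by (auto simp: Jw_def)
    have fin_Jw: "finite (Jw w)" for w using finite_subset[OF Jw_sub finJ] .
    have disj: "Jw v \<inter> Jw w = {}" if "v \<in> W" "w \<in> W" "v \<noteq> w" for v w
    proof (rule ccontr)
      assume "Jw v \<inter> Jw w \<noteq> {}"
      then obtain j x y where j: "j \<in> J" "x \<in> F" "y \<in> F" "g v x \<in> U j" "g w y \<in> U j"
        by (auto simp: Jw_def)
      have "dist (g v x) (g w y) \<le> diameter (U j)"
        using j bdU by (intro diameter_bounded_bound) auto
      thus False using small[OF j(1)] gap[OF that j(2,3)] by linarith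
    qed
    \<comment> \<open>Averaging: the families \<open>Jw w\<close> are disjoint, so the cheapest one
      carries at most a fraction 1 / \<open>?m\<close> of the total.\<close>
    have "\<exists>w\<in>W. ?m * (\<Sum>j\<in>Jw w. diameter (U j) powr t) \<le> ?T"
    proof (rule ccontr)
      assume "\<not> ?thesis"
      hence big: "?T < ?m * (\<Sum>j\<in>Jw w. diameter (U j) powr t)" if "w \<in> W" for w
        using that by (auto simp: not_le)
      have "?m * ?T = (\<Sum>w\<in>W. ?T)" by simp
      also have "\<dots> < (\<Sum>w\<in>W. ?m * (\<Sum>j\<in>Jw w. diameter (U j) powr t))"
        using W big by (intro sum_strict_mono) auto
      also have "\<dots> = ?m * (\<Sum>j\<in>(\<Union>w\<in>W. Jw w). diameter (U j) powr t)"
        using W(1) fin_Jw disj by (subst sum.UNION_disjoint) (auto simp: sum_distrib_left)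
      also have "\<dots> \<le> ?m * ?T"
        using finJ Jw_sub by (intro mult_left_mono sum_mono2) auto
      finally show False by simp
    qed
    then obtain w where w: "w \<in> W" "?m * (\<Sum>j\<in>Jw w. diameter (U j) powr t) \<le> ?T" by blast
    have cover: "\<exists>j\<in>Jw v. g v x \<in> U j" if "v \<in> W" "x \<in> F" for v x
      using g[OF that] FU that(2) by (fastforce simp: Jw_def)
    \<comment> \<open>A second copy needs at least one set of its own, so the family of
      \<open>w\<close> is strictly smaller than \<open>J\<close> and the induction hypothesis
      applies.\<close>
    obtain v where v: "v \<in> W" "v \<noteq> w"
    proof -
      have "W \<noteq> {w}" using W by auto
      thus ?thesis using that w(1) by blast
    qed
    obtain x0 where "x0 \<in> F" using F by blast
    with cover[OF v(1)] have "Jw v \<noteq> {}" by blast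
    hence "Jw w \<subset> J" using disj[OF v(1) w(1) v(2)] Jw_sub by blast
    hence lt: "card (Jw w) < card J" using finJ by (rule psubset_card_mono[rotated])
    define V where "V j = {x\<in>F. g w x \<in> U j}" for j
    have V: "diameter (V j) powr t \<le> \<rho> powr (- t) * diameter (U j) powr t" if "j \<in> J" for j
    proof -
      have "diameter (V j) \<le> diameter (U j) / \<rho>"
      proof (rule diameter_le)
        fix x y assume "x \<in> V j" "y \<in> V j"
        hence "dist (g w x) (g w y) \<le> diameter (U j)"
          using that bdU by (intro diameter_bounded_bound) (auto simp: V_def)
        with expand[OF w(1), of x y] have "\<rho> * dist x y \<le> diameter (U j)" by linarith
        thus "norm (x - y) \<le> diameter (U j) / \<rho>" using \<rho>(1) by (simp add: dist_norm field_simps)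
      qed (use diameter_ge_0[OF bdU[OF that]] \<rho> in auto)
      moreover have "bounded (V j)" by (rule bounded_subset[OF F(2)]) (auto simp: V_def)
      ultimately have "diameter (V j) powr t \<le> (diameter (U j) / \<rho>) powr t"
        using t by (intro powr_mono2) (auto simp: diameter_ge_0)
      also have "\<dots> = \<rho> powr (- t) * diameter (U j) powr t"
        using diameter_ge_0[OF bdU[OF that]] \<rho> by (simp add: powr_divide powr_minus field_simps)
      finally show ?thesis .
    qed
    have "\<eta> powr t \<le> (\<Sum>j\<in>Jw w. diameter (V j) powr t)"
    proof (rule less.hyps[OF lt fin_Jw])
      show "bounded (V j)" for j by (rule bounded_subset[OF F(2)]) (auto simp: V_def)
      show "F \<subseteq> (\<Union>j\<in>Jw w. V j)" using cover[OF w(1)] by (auto simp: V_def)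
    qed
    also have "\<dots> \<le> (\<Sum>j\<in>Jw w. \<rho> powr (- t) * diameter (U j) powr t)"
      using V Jw_sub by (intro sum_mono) auto
    also have "\<dots> = \<rho> powr (- t) * (\<Sum>j\<in>Jw w. diameter (U j) powr t)" by (simp add: sum_distrib_left)
    \<comment> \<open>The factor lost by pulling back is at most the number of copies, which the
      averaging has gained.\<close>
    also have "\<dots> \<le> ?m * (\<Sum>j\<in>Jw w. diameter (U j) powr t)"
    proof (intro mult_right_mono sum_nonneg)
      show "\<rho> powr (- t) \<le> ?m" using \<rho> by (simp add: powr_minus field_simps)
    qed auto
    also have "\<dots> \<le> ?T" by (rule w(2))
    finally show False using T by simp
  qed
qed

section \<open>Self-similar sets\<close>

text \<open>A finite cover is padded to a sequence with empty sets, which contribute nothing since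
  \<open>0 powr t = 0\<close>.\<close>

lemma hausdorff_measure_eq_0I:
  fixes F :: "'a::metric_space set"
  assumes "\<And>\<delta> e. 0 < \<delta> \<Longrightarrow> 0 < e \<Longrightarrow> \<exists>(A::'b set) U. finite A \<and> F \<subseteq> (\<Union>a\<in>A. U a) \<and>
      (\<forall>a\<in>A. bounded (U a) \<and> diameter (U a) \<le> \<delta>) \<and> (\<Sum>a\<in>A. diameter (U a) powr t) \<le> e"
  shows "hausdorff_measure t F = 0"
proof -
  have "(INF U\<in>{U::nat \<Rightarrow> 'a set. F \<subseteq> (\<Union>i. U i) \<and> (\<forall>i. bounded (U i) \<and> diameter (U i) \<le> \<delta>)}.
           (\<Sum>i. ennreal (diameter (U i) powr t))) \<le> 0" (is "Inf (?f ` ?C) \<le> 0") if \<delta>: "0 < \<delta>" for \<delta>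
  proof (rule ennreal_le_epsilon)
    fix e :: real assume "0 < e"
    from assms[OF \<delta> this] obtain A :: "'b set" and U where A: "finite A" "F \<subseteq> (\<Union>a\<in>A. U a)"
        "\<forall>a\<in>A. bounded (U a) \<and> diameter (U a) \<le> \<delta>" "(\<Sum>a\<in>A. diameter (U a) powr t) \<le> e"
      by (elim exE conjE) (rule that)
    obtain h where h: "bij_betw h {0..<card A} A" using ex_bij_betw_nat_finite[OF A(1)] by blast
    define V where "V i = (if i < card A then U (h i) else {})" for i
    have hA: "h i \<in> A" if "i < card A" for i using h that by (auto simp: bij_betw_def)
    have "F \<subseteq> (\<Union>i. V i)"
    proof
      fix x assume "x \<in> F"
      then obtain a where a: "a \<in> A" "x \<in> U a" using A(2) by blast
      hence "a \<in> h ` {0..<card A}" using h by (simp add: bij_betw_def)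
      then obtain i where "i < card A" "h i = a" by auto
      hence "x \<in> V i" using a(2) by (simp add: V_def)
      thus "x \<in> (\<Union>i. V i)" by blast
    qed
    hence "V \<in> ?C" using A(3) hA \<delta> by (auto simp: V_def)
    hence "Inf (?f ` ?C) \<le> ?f V" by (rule INF_lower)
    also have "?f V = (\<Sum>i<card A. ennreal (diameter (V i) powr t))"
      by (intro suminf_finite) (auto simp: V_def)
    also have "\<dots> = ennreal (\<Sum>i<card A. diameter (V i) powr t)" by (simp add: sum_ennreal)
    also have "(\<Sum>i<card A. diameter (V i) powr t) = (\<Sum>i\<in>{0..<card A}. diameter (U (h i)) powr t)"
      by (intro sum.cong) (auto simp: V_def)
    also have "\<dots> = (\<Sum>a\<in>A. diameter (U a) powr t)" by (rule sum.reindex_bij_betw[OF h])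
    also have "ennreal \<dots> \<le> ennreal e" using A(4) by (rule ennreal_leI)
    finally show "Inf (?f ` ?C) \<le> 0 + ennreal e" by simp
  qed
  thus ?thesis unfolding hausdorff_measure_def
    by (intro antisym SUP_least) auto
qed

lemma hausdorff_dim_le:
  assumes "0 < t" "hausdorff_measure t F = 0"
  shows "hausdorff_dim F \<le> t"
  unfolding hausdorff_dim_def using assms by (intro cInf_lower) (auto intro!: bdd_belowI[of _ 0])

lemma hausdorff_dim_nonneg:
  assumes "\<exists>t. 0 < t \<and> hausdorff_measure t F = 0"
  shows "0 \<le> hausdorff_dim F"
  unfolding hausdorff_dim_def using assms by (intro cInf_greatest) auto

section \<open>Words, their ratios and their similarities\<close>

lemma word_comp_Nil [simp]: "word_comp T [] = id"
  and word_comp_Cons [simp]: "word_comp T (i # w) = T i \<circ> word_comp T w"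
  by (simp_all add: word_comp_def)

lemma word_comp_append [simp]: "word_comp T (v @ w) = word_comp T v \<circ> word_comp T w"
  by (induction v) (simp_all add: comp_assoc)

lemma word_ratio_simps [simp]:
  "word_ratio c [] = 1" "word_ratio c (i # w) = c i * word_ratio c w"
  "word_ratio c (v @ w) = word_ratio c v * word_ratio c w"
  by (simp_all add: word_ratio_def)

text \<open>Expanding the n-th power of the sum yields one product for each word of length
  \<open>n\<close>.\<close>

lemma sum_word_ratio_powr:
  assumes "finite I" "\<And>i. i \<in> I \<Longrightarrow> 0 < c i"
  shows "(\<Sum>w | set w \<subseteq> I \<and> length w = n. word_ratio c w powr t) = (\<Sum>i\<in>I. c i powr t) ^ n"
proof (induction n)
  case 0
  have "{w. set w \<subseteq> I \<and> length w = 0} = {[]}" by auto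
  thus ?case by simp
next
  case (Suc n)
  let ?W = "{w. set w \<subseteq> I \<and> length w = n}"
  have pos: "0 < word_ratio c w" if "set w \<subseteq> I" for w
    using that assms(2) by (induction w) auto
  have "{w. set w \<subseteq> I \<and> length w = Suc n} = (\<lambda>(i, w). i # w) ` (I \<times> ?W)"
    by (auto simp: length_Suc_conv image_iff)
  hence "(\<Sum>w | set w \<subseteq> I \<and> length w = Suc n. word_ratio c w powr t)
      = (\<Sum>(i, w)\<in>I \<times> ?W. word_ratio c (i # w) powr t)"
    by (simp add: sum.reindex inj_on_def split_def del: word_ratio_simps)
  also have "\<dots> = (\<Sum>i\<in>I. \<Sum>w\<in>?W. c i powr t * word_ratio c w powr t)"
    unfolding sum.cartesian_product[symmetric] using pos assms(2)
    by (intro sum.cong refl) (auto simp: powr_mult less_imp_le)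
  also have "\<dots> = (\<Sum>i\<in>I. c i powr t) * (\<Sum>i\<in>I. c i powr t) ^ n"
    by (simp add: Suc.IH sum_distrib_right flip: sum_distrib_left)
  finally show ?case by simp
qed

locale similarity_ifs =
  fixes I :: "'i set" and c :: "'i \<Rightarrow> real"
    and M :: "'i \<Rightarrow> 'a::euclidean_space \<Rightarrow> 'a" and b :: "'i \<Rightarrow> 'a"
  assumes finite_I: "finite I" and I_nonempty: "I \<noteq> {}"
    and ratio: "\<And>i. i \<in> I \<Longrightarrow> 0 < c i \<and> c i < 1"
    and orth: "\<And>i. i \<in> I \<Longrightarrow> orthogonal_transformation (M i)"
begin

definition S :: "'i list \<Rightarrow> 'a \<Rightarrow> 'a" where
  "S = word_comp (\<lambda>i x. c i *\<^sub>R M i x + b i)"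

definition T :: "'i list \<Rightarrow> 'a \<Rightarrow> 'a" where
  "T = word_comp (\<lambda>i x. c i *\<^sub>R M i x)"

abbreviation cw :: "'i list \<Rightarrow> real" where
  "cw \<equiv> word_ratio c"

definition cmin :: real where "cmin = Min (c ` I)"
definition cmax :: real where "cmax = Max (c ` I)"

lemma S_simps [simp]: "S [] = id" "S (i # w) x = c i *\<^sub>R M i (S w x) + b i" "S (v @ w) x = S v (S w x)"
  by (simp_all add: S_def)

lemma T_simps [simp]: "T [] = id" "T (i # w) x = c i *\<^sub>R M i (T w x)"
  by (simp_all add: T_def)

lemma cmin: "0 < cmin" "cmin < 1" "i \<in> I \<Longrightarrow> cmin \<le> c i"
  unfolding cmin_def using finite_I I_nonempty ratio by (auto simp: Min_less_iff)

lemma cmax: "0 < cmax" "cmax < 1" "i \<in> I \<Longrightarrow> c i \<le> cmax"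
  unfolding cmax_def using finite_I I_nonempty ratio by (auto simp: Max_gr_iff)

lemma cw_pos: "set w \<subseteq> I \<Longrightarrow> 0 < cw w"
  using ratio by (induction w) auto

lemma cw_le: "set w \<subseteq> I \<Longrightarrow> cw w \<le> cmax ^ length w"
proof (induction w)
  case (Cons i w)
  thus ?case using cmax cw_pos[of w] ratio[of i] by (auto intro!: mult_mono)
qed simp

lemma linear_M: "i \<in> I \<Longrightarrow> linear (M i)"
  using orth by (rule orthogonal_transformation_linear)

lemma T_diff: "set w \<subseteq> I \<Longrightarrow> T w (x - y) = T w x - T w y"
  by (induction w) (auto simp: linear_diff[OF linear_M] scaleR_diff_right)

lemma norm_T: "set w \<subseteq> I \<Longrightarrow> norm (T w x) = cw w * norm x"
  using ratio by (induction w) (auto simp: orthogonal_transformation_norm[OF orth] less_imp_le)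

lemma S_diff: "set w \<subseteq> I \<Longrightarrow> S w x - S w y = T w (x - y)"
proof (induction w)
  case (Cons i w)
  hence "c i *\<^sub>R (M i (S w x) - M i (S w y)) = c i *\<^sub>R M i (T w (x - y))"
    by (simp flip: linear_diff[OF linear_M])
  thus ?case by (simp add: scaleR_diff_right)
qed simp

lemma dist_S: "set w \<subseteq> I \<Longrightarrow> dist (S w x) (S w y) = cw w * dist x y"
  by (simp add: dist_norm S_diff norm_T)

lemma dist_T: "set w \<subseteq> I \<Longrightarrow> dist (T w x) (T w y) = cw w * dist x y"
  by (simp add: dist_norm norm_T flip: T_diff)

lemma S_closed:
  assumes "\<And>i x. i \<in> I \<Longrightarrow> x \<in> F \<Longrightarrow> c i *\<^sub>R M i x + b i \<in> F" "set w \<subseteq> I" "x \<in> F"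
  shows "S w x \<in> F"
  using assms(2) by (induction w) (auto simp: assms)

lemma powr_sum_less_1:
  assumes "(\<Sum>i\<in>I. c i powr s) = 1" "s < t"
  shows "(\<Sum>i\<in>I. c i powr t) < 1"
proof -
  have "(\<Sum>i\<in>I. c i powr t) < (\<Sum>i\<in>I. c i powr s)"
    using finite_I I_nonempty ratio assms(2) by (intro sum_strict_mono powr_less_mono') auto
  thus ?thesis using assms(1) by simp
qed

end

section \<open>The homogeneous attractor\<close>

locale self_similar_set = similarity_ifs I c M b
  for I :: "'i set" and c :: "'i \<Rightarrow> real"
    and M :: "'i \<Rightarrow> 'a::euclidean_space \<Rightarrow> 'a" and b :: "'i \<Rightarrow> 'a" +
  fixes F0 :: "'a set" and s :: real
  assumes compact_F0: "compact F0" and F0_nonempty: "F0 \<noteq> {}"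
    and F0_eq: "F0 = (\<Union>i\<in>I. (\<lambda>x. c i *\<^sub>R M i x + b i) ` F0)"
    and s: "0 \<le> s" "(\<Sum>i\<in>I. c i powr s) = 1"
begin

lemma bounded_F0: "bounded F0"
  using compact_F0 by (rule compact_imp_bounded)

lemma S_F0: "set w \<subseteq> I \<Longrightarrow> x \<in> F0 \<Longrightarrow> S w x \<in> F0"
  by (rule S_closed) (use F0_eq in blast)

lemma F0_step:
  assumes "x \<in> F0"
  obtains i y where "i \<in> I" "y \<in> F0" "x = S [i] y"
proof -
  from assms have "x \<in> (\<Union>i\<in>I. (\<lambda>x. c i *\<^sub>R M i x + b i) ` F0)" using F0_eq by simp
  thus ?thesis using that by auto
qed

lemma F0_words:
  assumes "x \<in> F0"
  shows "\<exists>w. set w \<subseteq> I \<and> length w = n \<and> x \<in> S w ` F0"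
proof (induction n)
  case 0
  show ?case using assms by (intro exI[of _ "[]"]) auto
next
  case (Suc n)
  then obtain w y where w: "set w \<subseteq> I" "length w = n" "y \<in> F0" "x = S w y" by blast
  obtain i z where "i \<in> I" "z \<in> F0" "y = S [i] z" using F0_step[OF w(3)] by blast
  thus ?case using w by (intro exI[of _ "w @ [i]"]) (auto intro!: image_eqI[of _ _ z])
qed

text \<open>The copies of \<open>F0\<close> along words of length \<open>n\<close> form a cover of
  cost at most \<open>q ^ n * D powr t\<close>, where \<open>q < 1\<close> because \<open>t\<close>
  exceeds the similarity exponent \<open>s\<close>.\<close>

lemma hausdorff_measure_F0:
  assumes "s < t"
  shows "hausdorff_measure t F0 = 0"
proof (rule hausdorff_measure_eq_0I)
  fix \<delta> e :: real assume \<delta>e: "0 < \<delta>" "0 < e"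
  define q where "q = (\<Sum>i\<in>I. c i powr t)"
  define D where "D = diameter F0"
  have D: "0 \<le> D" unfolding D_def using diameter_ge_0 bounded_F0 by blast
  have q: "0 \<le> q" "q < 1" unfolding q_def using powr_sum_less_1[OF s(2) assms] by (auto intro: sum_nonneg)
  have "(\<lambda>n. cmax ^ n * D) \<longlonglongrightarrow> 0 * D"
    using cmax by (intro tendsto_mult_right LIMSEQ_power_zero) auto
  hence ev1: "\<forall>\<^sub>F n in sequentially. cmax ^ n * D < \<delta>" using \<delta>e by (simp add: order_tendsto_iff)
  have "(\<lambda>n. q ^ n * D powr t) \<longlonglongrightarrow> 0 * D powr t"
    using q by (intro tendsto_mult_right LIMSEQ_power_zero) auto
  hence ev2: "\<forall>\<^sub>F n in sequentially. q ^ n * D powr t < e" using \<delta>e by (simp add: order_tendsto_iff)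
  obtain n where n: "cmax ^ n * D < \<delta>" "q ^ n * D powr t < e"
    using eventually_happens[OF eventually_conj[OF ev1 ev2]] by auto
  let ?A = "{w. set w \<subseteq> I \<and> length w = n}"
  have bd: "bounded (S w ` F0)" "diameter (S w ` F0) \<le> cw w * D" if w: "set w \<subseteq> I" for w
  proof -
    show "bounded (S w ` F0)" by (rule bounded_subset[OF bounded_F0]) (use S_F0[OF w] in blast)
    show "diameter (S w ` F0) \<le> cw w * D"
    proof (rule diameter_le)
      fix x y assume "x \<in> S w ` F0" "y \<in> S w ` F0"
      then obtain x' y' where xy: "x = S w x'" "y = S w y'" "x' \<in> F0" "y' \<in> F0" by blast
      have "dist x y = cw w * dist x' y'" using w xy by (simp add: dist_S)
      also have "\<dots> \<le> cw w * D" unfolding D_def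
        using xy bounded_F0 cw_pos[OF w] by (intro mult_left_mono diameter_bounded_bound) auto
      finally show "norm (x - y) \<le> cw w * D" by (simp add: dist_norm)
    qed (use F0_nonempty in auto)
  qed
  have "(\<Sum>w\<in>?A. diameter (S w ` F0) powr t) \<le> (\<Sum>w\<in>?A. cw w powr t * D powr t)"
  proof (rule sum_mono)
    fix w assume w: "w \<in> ?A"
    hence "diameter (S w ` F0) powr t \<le> (cw w * D) powr t"
      using bd assms s by (intro powr_mono2) (auto simp: diameter_ge_0)
    thus "diameter (S w ` F0) powr t \<le> cw w powr t * D powr t"
      using w cw_pos[of w] D by (simp add: powr_mult)
  qed
  also have "\<dots> = q ^ n * D powr t"
    using sum_word_ratio_powr[where c = c and n = n and t = t, OF finite_I] ratio by (simp add: q_def flip: sum_distrib_right)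
  finally have "(\<Sum>w\<in>?A. diameter (S w ` F0) powr t) \<le> e" using n by linarith
  moreover have "finite ?A" using finite_I by (rule finite_lists_length_eq)
  moreover have "F0 \<subseteq> (\<Union>w\<in>?A. S w ` F0)" using F0_words[of _ n] by blast
  moreover have "bounded (S w ` F0) \<and> diameter (S w ` F0) \<le> \<delta>" if "w \<in> ?A" for w
  proof -
    have "diameter (S w ` F0) \<le> cw w * D" using bd that by blast
    also have "\<dots> \<le> cmax ^ n * D" using cw_le[of w] that D by (auto intro!: mult_right_mono)
    finally show ?thesis using bd that n by auto
  qed
  ultimately show "\<exists>(A :: 'i list set) U. finite A \<and> F0 \<subseteq> (\<Union>a\<in>A. U a) \<and>
      (\<forall>a\<in>A. bounded (U a) \<and> diameter (U a) \<le> \<delta>) \<and> (\<Sum>a\<in>A. diameter (U a) powr t) \<le> e"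
    by (intro exI[of _ ?A] exI[of _ "\<lambda>w. S w ` F0"]) blast
qed

lemma ex_hausdorff_measure_F0_eq_0: "\<exists>t. 0 < t \<and> hausdorff_measure t F0 = 0"
  using hausdorff_measure_F0[of "s + 1"] s by (intro exI[of _ "s + 1"]) auto

lemma hausdorff_dim_F0_le: "hausdorff_dim F0 \<le> s"
proof (rule field_le_epsilon)
  fix e :: real assume "0 < e"
  thus "hausdorff_dim F0 \<le> s + e" using s by (intro hausdorff_dim_le hausdorff_measure_F0) auto
qed

text \<open>Follow an address of \<open>x\<close> until the ratio first drops to \<open>r\<close> or
  below. The last letter shrinks it by at most the factor \<open>cmin\<close>, and
  \<open>cmax ^ n < r\<close> forces the process to stop.\<close>

lemma F0_stopping_word:
  assumes "x \<in> F0" "0 < r" "r \<le> 1"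
  shows "\<exists>w. set w \<subseteq> I \<and> cmin * r \<le> cw w \<and> cw w \<le> r \<and> x \<in> S w ` F0"
proof -
  have claim: "(\<exists>w. set w \<subseteq> I \<and> cmin * r \<le> cw w \<and> cw w \<le> r \<and> x \<in> S w ` F0) \<or>
      (\<exists>w. set w \<subseteq> I \<and> length w = n \<and> r < cw w \<and> x \<in> S w ` F0)" (is "?A \<or> ?B n") for n
  proof (induction n)
    case 0
    show ?case
    proof (cases "r = 1")
      case True
      thus ?thesis using assms cmin by (intro disjI1 exI[of _ "[]"]) auto
    next
      case False
      thus ?thesis using assms by (intro disjI2 exI[of _ "[]"]) auto
    qed
  next
    case (Suc n)
    show ?case
    proof (cases ?A)
      case False
      then obtain w y where w: "set w \<subseteq> I" "length w = n" "r < cw w" "y \<in> F0" "x = S w y"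
        using Suc.IH by blast
      obtain i z where iz: "i \<in> I" "z \<in> F0" "y = S [i] z" using F0_step[OF w(4)] by blast
      have x: "x \<in> S (w @ [i]) ` F0" using w(5) iz(2,3) by auto
      have "cmin * r \<le> c i * cw w" using cmin iz(1) w(3) assms ratio[OF iz(1)] by (intro mult_mono) auto
      hence le: "cmin * r \<le> cw (w @ [i])" by (simp add: mult.commute)
      have sub: "set (w @ [i]) \<subseteq> I" using w(1) iz(1) by simp
      have "r < cw (w @ [i])" using False x le sub by (meson not_le)
      thus ?thesis using x sub w(2) by (intro disjI2 exI[of _ "w @ [i]"]) auto
    qed blast
  qed
  have "\<exists>n. cmax ^ n < r" using cmax assms(2) by (intro real_arch_pow_inv) auto
  then obtain n where n: "cmax ^ n < r" by blast
  have "\<not> (\<exists>w. set w \<subseteq> I \<and> length w = n \<and> r < cw w \<and> x \<in> S w ` F0)"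
    using cw_le n by fastforce
  thus ?thesis using claim[of n] by blast
qed

text \<open>The sets \<open>S w ` F0\<close> for stopping words \<open>w\<close> through a separated subset of \<open>F0\<close> are uniformly
  separated copies of \<open>F0\<close>. If there were too many of them, they would generate a subset of \<open>F0\<close>
  of too large Hausdorff dimension.\<close>

lemma cov_F0:
  assumes t: "hausdorff_dim F0 < t"
  shows "\<exists>K>0. \<forall>r. 0 < r \<longrightarrow> r \<le> 1 \<longrightarrow> cov F0 r (K * r powr (- t))"
proof -
  have t0: "0 < t" using t hausdorff_dim_nonneg[OF ex_hausdorff_measure_F0_eq_0] by linarith
  \<comment> \<open>The summand 1 keeps \<open>D\<close> positive when \<open>F0\<close> is a single
    point.\<close>
  define D where "D = diameter F0 + 1"
  have D: "0 < D" unfolding D_def using diameter_ge_0[OF bounded_F0] by linarith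
  have distD: "dist x y \<le> D" if "x \<in> F0" "y \<in> F0" for x y
    unfolding D_def using diameter_bounded_bound[OF bounded_F0 that] by linarith
  \<comment> \<open>Each point is within \<open>D * r\<close> of its whole copy, so separation 3
    \<open>D * r\<close> of the points leaves a gap \<open>D * r\<close> between the copies.\<close>
  have "cov F0 ((3 * D) * r) (cmin powr (- t) * r powr (- t))" if r: "0 < r" "r \<le> 1" for r
  proof (rule cov_of_separated_bound)
    fix P assume P: "finite P" "P \<subseteq> F0" "\<forall>x\<in>P. \<forall>y\<in>P. x \<noteq> y \<longrightarrow> 3 * D * r < dist x y"
    have "\<forall>x\<in>P. \<exists>w. set w \<subseteq> I \<and> cmin * r \<le> cw w \<and> cw w \<le> r \<and> x \<in> S w ` F0"
      using F0_stopping_word r P(2) by blast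
    then obtain w where w: "\<And>x. x \<in> P \<Longrightarrow> set (w x) \<subseteq> I" "\<And>x. x \<in> P \<Longrightarrow> cmin * r \<le> cw (w x)"
        "\<And>x. x \<in> P \<Longrightarrow> cw (w x) \<le> r" "\<And>x. x \<in> P \<Longrightarrow> x \<in> S (w x) ` F0" by metis
    have near: "dist x (S (w x) y) \<le> D * r" if xy: "x \<in> P" "y \<in> F0" for x y
    proof -
      obtain x' where x': "x = S (w x) x'" "x' \<in> F0" using w(4)[OF xy(1)] by blast
      have "dist x (S (w x) y) = cw (w x) * dist x' y" using w(1)[OF xy(1)] x'(1) by (metis dist_S)
      also have "\<dots> \<le> r * D" using w(3)[OF xy(1)] distD[OF x'(2) xy(2)] r by (intro mult_mono) auto
      finally show ?thesis by (simp add: mult.commute)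
    qed
    show "real (card P) \<le> cmin powr (- t) * r powr (- t)"
    proof (rule ccontr)
      \<comment> \<open>With \<rho> = \<open>cmin * r\<close> there are then at least two copies and
        their number times \<rho> to the power \<open>t\<close> is at least 1. So every finite cover
        of \<open>F0\<close> costs at least \<open>(D * r) powr t\<close>, while
        \<open>hausdorff_dim F0 < t\<close> provides cheaper ones.\<close>
      assume "\<not> ?thesis"
      moreover have eq: "cmin powr (- t) * r powr (- t) = (cmin * r) powr (- t)"
        using cmin r by (simp add: powr_mult)
      ultimately have big: "(cmin * r) powr (- t) < real (card P)" by simp
      have \<rho>: "0 < cmin * r" "cmin * r \<le> 1" using cmin r by (auto intro: mult_le_one)
      have pw: "0 < (cmin * r) powr t" using cmin(1) r by simp
      have "(cmin * r) powr t \<le> 1" using \<rho> t0 by (intro powr_le1) auto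
      with pw have "1 \<le> (cmin * r) powr (- t)"
        unfolding powr_minus by (intro one_le_inverse)
      hence two: "2 \<le> card P" using big by linarith
      have one: "1 \<le> real (card P) * (cmin * r) powr t"
        using mult_strict_right_mono[OF big pw] pw unfolding powr_minus by simp
      obtain J :: "nat set" and V where J: "finite J" "\<And>j. j \<in> J \<Longrightarrow> bounded (V j)" "F0 \<subseteq> (\<Union>j\<in>J. V j)"
          "(\<Sum>j\<in>J. diameter (V j) powr t) < (D * r) powr t"
        using ex_finite_cover_of_hausdorff_dim[OF compact_F0 ex_hausdorff_measure_F0_eq_0 t t0,
          of "(D * r) powr t"] D r by auto
      have "(D * r) powr t \<le> (\<Sum>j\<in>J. diameter (V j) powr t)"
      proof (rule diameter_sum_ge_of_separated_copies[where g = "\<lambda>x. S (w x)",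
            OF P(1) two \<rho>(1) one t0 _ F0_nonempty bounded_F0])
        show "0 < D * r" using D r by simp
        show "S (w x) y \<in> F0" if "x \<in> P" "y \<in> F0" for x y using S_F0 w(1) that by blast
        show "cmin * r * dist y z \<le> dist (S (w x) y) (S (w x) z)" if "x \<in> P" for x y z
          using w(1,2)[OF that] by (simp add: dist_S mult_right_mono)
        show "D * r \<le> dist (S (w x) y) (S (w x') z)"
          if "x \<in> P" "x' \<in> P" "x \<noteq> x'" "y \<in> F0" "z \<in> F0" for x x' y z
        proof -
          have "3 * (D * r) < dist x x'" using P(3) that by (simp add: mult.assoc)
          moreover have "dist x x' \<le> dist x (S (w x) y) + dist (S (w x) y) (S (w x') z) + dist x' (S (w x') z)"
            using dist_triangle[of x x' "S (w x) y"] dist_triangle[of "S (w x) y" x' "S (w x') z"]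
            by (simp add: dist_commute)
          ultimately show ?thesis using near[OF that(1,4)] near[OF that(2,5)] by linarith
        qed
      qed (use J in auto)
      thus False using J(4) by linarith
    qed
  qed (use D r in simp)
  hence "cov F0 r (cmin powr (- t) * r powr (- t) * (1 + 2 * (3 * D)) ^ DIM('a))"
    if "0 < r" "r \<le> 1" for r
    using that D by (intro cov_rescale[of F0 "3 * D"]) auto
  thus ?thesis using cmin D
    by (intro exI[of _ "cmin powr (- t) * (1 + 2 * (3 * D)) ^ DIM('a)"]) (auto simp: mult_ac)
qed

end

section \<open>Counting words\<close>

text \<open>Bernoulli's inequality for the base \<open>2 powr e\<close>. It turns polynomial
  factors, such as the number of levels or of ratios, into a loss of e in the exponent.\<close>

lemma linear_le_powr:
  fixes e :: real
  assumes "0 < e"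
  shows "\<exists>K>0. \<forall>k::nat. real k + 1 \<le> K * 2 powr (real k * e)"
proof -
  define u where "u = 2 powr e - 1"
  define v where "v = min 1 u"
  have u: "0 < u" unfolding u_def using assms by simp
  have v: "0 < v" "v \<le> 1" "v \<le> u" using u by (auto simp: v_def)
  have "real k + 1 \<le> (1 / v) * 2 powr (real k * e)" for k
  proof -
    have "v * (real k + 1) \<le> 1 + real k * u"
      using v mult_left_mono[of v u "real k"] by (simp add: algebra_simps)
    also have "\<dots> \<le> (1 + u) ^ k" using u by (intro Bernoulli_inequality) simp
    also have "\<dots> = 2 powr (real k * e)" unfolding u_def by (simp add: powr_powr mult.commute flip: powr_realpow)
    finally show ?thesis using v by (simp add: field_simps)
  qed
  thus ?thesis using v by (intro exI[of _ "1 / v"]) auto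
qed

context similarity_ifs
begin

text \<open>Unlike \<open>words_k\<close>, level \<open>0\<close> contains the empty word, which accounts for \<open>C\<close> itself.\<close>

definition W :: "nat \<Rightarrow> 'i list set" where
  "W k = {w. set w \<subseteq> I \<and> 2 powr (- (real k + 1)) < cw w \<and> cw w \<le> 2 powr (- real k)}"

lemma W_D:
  assumes "w \<in> W k"
  shows "set w \<subseteq> I" "2 powr (- (real k + 1)) < cw w" "cw w \<le> 2 powr (- real k)"
  using assms by (auto simp: W_def)

lemma W_subset_words_k: "W k \<subseteq> insert [] (words_k I c k)"
  by (auto simp: W_def words_k_def)

text \<open>If \<open>L\<close> letters shrink by more than a half, then \<open>L * (k + 1)\<close>
  letters push the ratio down to the excluded lower end of level \<open>k\<close>.\<close>

lemma ex_length_bound_W: "\<exists>L. \<forall>k. \<forall>w\<in>W k. length w < L * (k + 1)"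
proof -
  obtain L where L: "cmax ^ L < 1 / 2" using real_arch_pow_inv[of "1 / 2" cmax] cmax by auto
  have "length w < L * (k + 1)" if w: "w \<in> W k" for w k
  proof (rule ccontr)
    assume "\<not> length w < L * (k + 1)"
    hence "cmax ^ length w \<le> cmax ^ (L * (k + 1))" using cmax by (intro power_decreasing) auto
    also have "\<dots> = (cmax ^ L) ^ (k + 1)" by (rule power_mult)
    also have "\<dots> \<le> (1 / 2) ^ (k + 1)" using L cmax by (intro power_mono) auto
    also have "\<dots> = inverse (2 ^ (k + 1))" by (simp add: power_one_over inverse_eq_divide)
    also have "(2::real) ^ (k + 1) = 2 powr real (k + 1)" by (rule powr_realpow[symmetric]) simp
    also have "inverse \<dots> = 2 powr (- (real k + 1))" by (simp add: algebra_simps flip: powr_minus)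
    finally show False using cw_le[OF W_D(1)[OF w]] W_D(2)[OF w] by linarith
  qed
  thus ?thesis by blast
qed

lemma finite_W: "finite (W k)"
proof -
  obtain L where "\<And>w. w \<in> W k \<Longrightarrow> length w < L * (k + 1)" using ex_length_bound_W by blast
  hence "W k \<subseteq> {w. set w \<subseteq> I \<and> length w \<le> L * (k + 1)}" using W_D(1) less_imp_le by blast
  thus ?thesis using finite_lists_length_le[OF finite_I] by (rule finite_subset)
qed

text \<open>Each word of level \<open>k\<close> contributes at least
  \<open>2 powr (- (real k + 1) * (s + e))\<close> to the sum of \<open>cw w powr (s + e)\<close>
  over all words. Grouped by length, that sum is a geometric series, convergent because of
  e.\<close>

lemma card_W_le:
  assumes s: "0 \<le> s" "(\<Sum>i\<in>I. c i powr s) = 1" and e: "0 < e"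
  shows "\<exists>K>0. \<forall>k. real (card (W k)) \<le> K * 2 powr (real k * (s + e))"
proof -
  define q where "q = (\<Sum>i\<in>I. c i powr (s + e))"
  have q: "0 \<le> q" "q < 1" unfolding q_def using powr_sum_less_1[OF s(2)] e by (auto intro: sum_nonneg)
  have "real (card (W k)) \<le> (2 powr (s + e) / (1 - q)) * 2 powr (real k * (s + e))" for k
  proof -
    obtain L where L: "\<And>w. w \<in> W k \<Longrightarrow> length w < L * (k + 1)" using ex_length_bound_W by blast
    let ?N = "L * (k + 1)"
    let ?V = "\<lambda>n. {w. set w \<subseteq> I \<and> length w = n}"
    have fin: "finite (?V n)" for n using finite_I by (rule finite_lists_length_eq)
    have "real (card (W k)) * (2 powr (- (real k + 1))) powr (s + e) = (\<Sum>w\<in>W k. (2 powr (- (real k + 1))) powr (s + e))"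
      by simp
    also have "\<dots> \<le> (\<Sum>w\<in>W k. cw w powr (s + e))"
      using s e by (intro sum_mono powr_mono2) (auto dest: W_D(2))
    also have "\<dots> \<le> (\<Sum>w\<in>(\<Union>n<?N. ?V n). cw w powr (s + e))"
      using fin L W_D(1) by (intro sum_mono2) auto
    also have "\<dots> = (\<Sum>n<?N. \<Sum>w\<in>?V n. cw w powr (s + e))"
      using fin by (intro sum.UNION_disjoint) auto
    also have "\<dots> = (\<Sum>n<?N. q ^ n)"
      using sum_word_ratio_powr[where c = c and t = "s + e", OF finite_I] ratio by (simp add: q_def)
    also have "\<dots> \<le> (\<Sum>n. q ^ n)" using q by (intro sum_le_suminf summable_geometric) auto
    also have "\<dots> = 1 / (1 - q)" using q by (intro suminf_geometric) auto
    also have "(2 powr (- (real k + 1))) powr (s + e) = 1 / (2 powr (s + e) * 2 powr (real k * (s + e)))"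
    proof -
      have "- (real k + 1) * (s + e) = - ((s + e) + real k * (s + e))" by (simp add: algebra_simps)
      hence "(2 powr (- (real k + 1))) powr (s + e) = 2 powr (- ((s + e) + real k * (s + e)))"
        by (simp only: powr_powr)
      also have "\<dots> = inverse (2 powr (s + e) * 2 powr (real k * (s + e)))"
        unfolding powr_minus powr_add[of 2 "s + e" "real k * (s + e)"] ..
      finally show ?thesis by (simp add: inverse_eq_divide)
    qed
    finally show ?thesis by (simp add: field_simps)
  qed
  thus ?thesis using q by (intro exI[of _ "2 powr (s + e) / (1 - q)"]) auto
qed

lemma cw_eq_prod: "set w \<subseteq> I \<Longrightarrow> cw w = (\<Prod>i\<in>I. c i ^ count_list w i)"
proof (induction w)
  case (Cons j w)
  have "(\<Prod>i\<in>I. c i ^ count_list (j # w) i) = (\<Prod>i\<in>I. (if i = j then c i else 1) * c i ^ count_list w i)"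
    by (intro prod.cong) auto
  also have "\<dots> = c j * cw w" using Cons finite_I by (simp add: prod.distrib prod.delta')
  finally show ?case by simp
qed simp

text \<open>The ratio of a word only depends on the number of occurrences of each letter, so words of
  level \<open>k\<close> have only polynomially many ratios.\<close>

lemma card_ratios_le:
  assumes e: "0 < e"
  shows "\<exists>K>0. \<forall>k. real (card (cw ` W k)) \<le> K * 2 powr (real k * e)"
proof -
  obtain L where L: "\<And>k w. w \<in> W k \<Longrightarrow> length w < L * (k + 1)" using ex_length_bound_W by blast
  let ?d = "card I"
  have d: "0 < ?d" using finite_I I_nonempty by (simp add: card_gt_0_iff)
  \<comment> \<open>The occurrence counts number at most a polynomial of degree
    \<open>card I\<close> in k, hence the share e / \<open>card I\<close> for each letter.\<close>
  obtain K where K: "0 < K" "\<And>k::nat. real k + 1 \<le> K * 2 powr (real k * (e / real ?d))"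
    using linear_le_powr[of "e / real ?d"] e d by auto
  have "real (card (cw ` W k)) \<le> ((real L + 1) * K) ^ ?d * 2 powr (real k * e)" for k
  proof -
    let ?N = "L * (k + 1)"
    let ?F = "PiE I (\<lambda>_. {..<?N})"
    have "cw ` W k \<subseteq> (\<lambda>f. \<Prod>i\<in>I. c i ^ f i) ` ?F"
    proof
      fix r assume "r \<in> cw ` W k"
      then obtain w where w: "w \<in> W k" "r = cw w" by blast
      have "restrict (count_list w) I \<in> ?F"
        using L[OF w(1)] count_le_length[of w] by (auto intro: le_less_trans)
      moreover have "r = (\<Prod>i\<in>I. c i ^ restrict (count_list w) I i)"
        using cw_eq_prod[OF W_D(1)[OF w(1)]] w(2) by simp
      ultimately show "r \<in> (\<lambda>f. \<Prod>i\<in>I. c i ^ f i) ` ?F" by blast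
    qed
    hence "card (cw ` W k) \<le> card ?F"
      using finite_I by (intro surj_card_le finite_PiE) auto
    also have "card ?F = ?N ^ ?d" using finite_I by (simp add: card_PiE)
    finally have "real (card (cw ` W k)) \<le> (real L * (real k + 1)) ^ ?d"
      by (simp add: algebra_simps flip: of_nat_le_iff[where 'a = real])
    also have "\<dots> \<le> ((real L + 1) * (K * 2 powr (real k * (e / real ?d)))) ^ ?d"
      using K(2)[of k] by (intro power_mono mult_mono) auto
    also have "\<dots> = ((real L + 1) * K) ^ ?d * (2 powr (real k * (e / real ?d))) ^ ?d"
      by (simp add: power_mult_distrib)
    also have "(2 powr (real k * (e / real ?d))) ^ ?d = 2 powr (real k * e)"
      using d by (simp add: powr_powr flip: powr_realpow)
    finally show ?thesis .
  qed
  thus ?thesis using K by (intro exI[of _ "((real L + 1) * K) ^ ?d"]) auto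
qed

text \<open>The upper limit bounds the counts only from some \<open>k0\<close> on, and
  \<open>K\<close> absorbs the earlier ones. The empty word, possible in \<open>W\<close> but not in
  \<open>words_k\<close>, adds at most one map.\<close>

lemma card_T_le:
  assumes \<gamma>: "0 \<le> \<gamma>"
    and lim: "limsup (\<lambda>k. ereal (real (card (T ` words_k I c k)) powr (1 / real k))) = ereal (2 powr \<gamma>)"
    and e: "0 < e"
  shows "\<exists>K>0. \<forall>k. real (card (T ` W k)) \<le> K * 2 powr (real k * (\<gamma> + e))"
proof -
  let ?N = "\<lambda>k. real (card (T ` words_k I c k))"
  have "limsup (\<lambda>k. ereal (?N k powr (1 / real k))) < ereal (2 powr (\<gamma> + e))"
    unfolding lim using e by simp
  hence "\<forall>\<^sub>F k in sequentially. ereal (?N k powr (1 / real k)) < ereal (2 powr (\<gamma> + e))"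
    by (rule Limsup_lessD)
  then obtain k0 where k0: "\<And>k. k0 \<le> k \<Longrightarrow> ?N k powr (1 / real k) < 2 powr (\<gamma> + e)"
    unfolding eventually_sequentially by auto
  define K where "K = 1 + (\<Sum>j\<le>k0. ?N j)"
  have "0 \<le> (\<Sum>j\<le>k0. ?N j)" by (intro sum_nonneg) auto
  hence K: "1 \<le> K" by (simp add: K_def)
  have main: "?N k \<le> K * 2 powr (real k * (\<gamma> + e))" for k
  proof -
    have ge1: "1 \<le> 2 powr (real k * (\<gamma> + e))" using \<gamma> e by (intro ge_one_powr_ge_zero) auto
    show ?thesis
    proof (cases "k \<le> k0")
      \<comment> \<open>This case includes k = 0, where \<open>1 / real k\<close> is 0 and the root
        says nothing about the count.\<close>
      case True
      hence "?N k \<le> (\<Sum>j\<le>k0. ?N j)" by (intro member_le_sum) auto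
      hence "?N k \<le> K" by (simp add: K_def)
      also have "\<dots> \<le> K * 2 powr (real k * (\<gamma> + e))" using K ge1 by (simp add: mult_le_cancel_left1)
      finally show ?thesis .
    next
      case False
      hence k: "0 < k" by simp
      have "?N k = (?N k powr (1 / real k)) powr real k" using k by (simp add: powr_powr)
      also have "\<dots> \<le> (2 powr (\<gamma> + e)) powr real k"
        using k0[of k] False by (intro powr_mono2) auto
      also have "\<dots> = 2 powr (real k * (\<gamma> + e))" by (simp add: powr_powr mult.commute)
      also have "\<dots> \<le> K * 2 powr (real k * (\<gamma> + e))" using K by (simp add: mult_le_cancel_right1)
      finally show ?thesis .
    qed
  qed
  have "real (card (T ` W k)) \<le> (K + 1) * 2 powr (real k * (\<gamma> + e))" for k
  proof -
    have "words_k I c k \<subseteq> W k" by (auto simp: W_def words_k_def)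
    hence fin: "finite (words_k I c k)" using finite_W finite_subset by blast
    have "T ` W k \<subseteq> insert (T []) (T ` words_k I c k)" using W_subset_words_k[of k] by blast
    hence "card (T ` W k) \<le> card (insert (T []) (T ` words_k I c k))"
      using fin by (intro card_mono) auto
    also have "\<dots> \<le> Suc (card (T ` words_k I c k))" by (rule card_insert_le_m1) auto
    finally have "real (card (T ` W k)) \<le> ?N k + 1" by linarith
    moreover have "1 \<le> 2 powr (real k * (\<gamma> + e))" using \<gamma> e by (intro ge_one_powr_ge_zero) auto
    ultimately show ?thesis using main[of k] by (simp add: algebra_simps)
  qed
  thus ?thesis using K by (intro exI[of _ "K + 1"]) auto
qed

end

section \<open>Covering one level of the orbital set\<close>

lemma two_powr_le_1: "x \<le> 0 \<Longrightarrow> (2::real) powr x \<le> 1"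
  using powr_mono[of x 0 2] by simp

lemma two_powr_uminus_powr: "((2::real) powr (- x)) powr (- y) = 2 powr (x * y)"
  by (simp add: powr_powr)

locale orbital_set = self_similar_set I c M b F0 s
  for I :: "'i set" and c :: "'i \<Rightarrow> real"
    and M :: "'i \<Rightarrow> 'a::euclidean_space \<Rightarrow> 'a" and b :: "'i \<Rightarrow> 'a"
    and F0 :: "'a set" and s :: real +
  fixes C :: "'a set" and p :: 'a and D :: real
  assumes p: "p \<in> F0" and D: "0 \<le> D" "\<And>x. x \<in> C \<Longrightarrow> dist x p \<le> D"
begin

definition G :: "nat \<Rightarrow> 'a set" where
  "G k = (\<Union>w\<in>W k. S w ` C)"

lemma S_decomp:
  assumes "set w \<subseteq> I"
  shows "S w x = S w p + T w (x - p)"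
  using S_diff[OF assms, of x p] by (simp add: algebra_simps)

lemma dist_T_diff: "set w \<subseteq> I \<Longrightarrow> dist (T w (x - p)) (T w (y - p)) = cw w * dist x y"
  by (simp add: dist_T) (simp add: dist_norm)

lemma scale_split: "(2::real) powr (- real n) = 2 powr (- real k) * 2 powr (- (real n - real k))"
  by (simp flip: powr_add)

lemma cw_scale_le:
  assumes "w \<in> W k"
  shows "cw w * 2 powr (- (real n - real k)) \<le> 2 powr (- real n)"
  unfolding scale_split[of n k] using W_D(3)[OF assms] by (intro mult_right_mono) auto

lemma cov_G_by_words:
  assumes KC: "\<And>r. 0 < r \<Longrightarrow> r \<le> 1 \<Longrightarrow> cov C r (KC * r powr (- \<beta>))"
    and Kw: "real (card (W k)) \<le> Kw * 2 powr (real k * t)" and k: "k \<le> n"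
  shows "cov (G k) (2 powr (- real n)) (Kw * KC * 2 powr (real k * t + (real n - real k) * \<beta>))"
proof -
  let ?r = "2 powr (- (real n - real k))"
  have C: "cov C ?r (KC * ?r powr (- \<beta>))" using k by (intro KC two_powr_le_1) auto
  have "cov (G k) (2 powr (- real n)) ((Kw * 2 powr (real k * t)) * (KC * ?r powr (- \<beta>)))"
    unfolding G_def
  proof (rule cov_UN_const[OF finite_W _ Kw])
    fix w assume w: "w \<in> W k"
    have "cov (S w ` C) (cw w * ?r) (KC * ?r powr (- \<beta>))"
      using C W_D(1)[OF w] cw_pos by (intro cov_lipschitz_image) (auto simp: dist_S less_imp_le)
    thus "cov (S w ` C) (2 powr (- real n)) (KC * ?r powr (- \<beta>))"
      using cw_scale_le[OF w] by (elim cov_mono) auto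
  qed (rule cov_nonneg[OF C])
  thus ?thesis unfolding two_powr_uminus_powr powr_add by (simp only: mult_ac)
qed

lemma cov_G_by_neighbourhood:
  assumes KF: "\<And>r. 0 < r \<Longrightarrow> r \<le> 1 \<Longrightarrow> cov F0 r (KF * r powr (- \<alpha>))" and k: "k \<le> n"
  shows "cov (G k) (2 powr (- real n))
    (KF * (3 + 2 * D) ^ DIM('a) * 2 powr (real k * \<alpha> + (real n - real k) * real DIM('a)))"
proof -
  let ?d = "DIM('a)"
  \<comment> \<open>The ratio of the radius (1 + D) \<open>2 powr (- real k)\<close> of the
    thickened balls to the final radius; its power \<open>DIM('a)\<close> is the price of refining
    one ball.\<close>
  let ?L = "(1 + D) * 2 powr (real n - real k)"
  have F0: "cov F0 (2 powr (- real k)) (KF * (2 powr (- real k)) powr (- \<alpha>))"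
    by (intro KF two_powr_le_1) auto
  have "cov (G k) (2 powr (- real k) + D * 2 powr (- real k)) (KF * (2 powr (- real k)) powr (- \<alpha>))"
    using F0
  proof (rule cov_nbhd)
    fix y assume "y \<in> G k"
    then obtain w x where w: "w \<in> W k" "x \<in> C" "y = S w x" by (auto simp: G_def)
    have "dist y (S w p) = cw w * dist x p" using w W_D(1)[OF w(1)] by (simp add: dist_S)
    also have "\<dots> \<le> 2 powr (- real k) * D" using W_D(3)[OF w(1)] D w by (intro mult_mono) auto
    finally show "\<exists>z\<in>F0. dist y z \<le> D * 2 powr (- real k)"
      using S_F0[OF W_D(1)[OF w(1)] p] by (auto simp: mult.commute)
  qed
  also have "2 powr (- real k) + D * 2 powr (- real k) = ?L * 2 powr (- real n)"
    by (simp add: algebra_simps flip: powr_add)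
  finally have "cov (G k) (2 powr (- real n)) (KF * (2 powr (- real k)) powr (- \<alpha>) * (1 + 2 * ?L) ^ ?d)"
    using D by (intro cov_rescale) auto
  moreover have "(1 + 2 * ?L) ^ ?d \<le> ((3 + 2 * D) * 2 powr (real n - real k)) ^ ?d"
  proof (intro power_mono)
    have "1 \<le> 2 powr (real n - real k)" using k by (intro ge_one_powr_ge_zero) auto
    thus "1 + 2 * ?L \<le> (3 + 2 * D) * 2 powr (real n - real k)" by (simp add: algebra_simps)
  qed (use D in auto)
  ultimately have "cov (G k) (2 powr (- real n))
      (KF * (2 powr (- real k)) powr (- \<alpha>) * ((3 + 2 * D) * 2 powr (real n - real k)) ^ ?d)"
    using cov_nonneg[OF F0] by (elim cov_mono) (auto intro: mult_left_mono)
  moreover have "(2 powr (real n - real k)) ^ ?d = 2 powr ((real n - real k) * real ?d)"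
    by (simp add: powr_powr flip: powr_realpow)
  ultimately show ?thesis
    by (simp add: powr_powr powr_add power_mult_distrib mult_ac)
qed

text \<open>The translations enter only through \<open>S w p\<close>, a point of \<open>F0\<close>.
  One cover of \<open>F0\<close> at the final scale therefore serves all words at once, and only
  linear images of \<open>C - p\<close> remain to be covered.\<close>

lemma cov_G_of_differences:
  assumes KF: "\<And>r. 0 < r \<Longrightarrow> r \<le> 1 \<Longrightarrow> cov F0 r (KF * r powr (- \<alpha>))"
    and B: "cov (\<Union>w\<in>W k. (\<lambda>x. T w (x - p)) ` C) r N"
  shows "cov (G k) (2 powr (- real n) + r) (KF * 2 powr (real n * \<alpha>) * N)"
proof -
  have "cov F0 (2 powr (- real n)) (KF * (2 powr (- real n)) powr (- \<alpha>))"
    by (intro KF two_powr_le_1) auto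
  hence F0: "cov F0 (2 powr (- real n)) (KF * 2 powr (real n * \<alpha>))" by (simp add: powr_powr)
  show ?thesis
  proof (rule cov_mono[OF cov_Minkowski[OF F0 B]])
    show "G k \<subseteq> {y + z |y z. y \<in> F0 \<and> z \<in> (\<Union>w\<in>W k. (\<lambda>x. T w (x - p)) ` C)}"
    proof
      fix y assume "y \<in> G k"
      then obtain w x where w: "w \<in> W k" "x \<in> C" "y = S w x" by (auto simp: G_def)
      have "y = S w p + T w (x - p)" using w S_decomp[OF W_D(1)] by blast
      moreover have "S w p \<in> F0" using S_F0[OF W_D(1)[OF w(1)] p] .
      ultimately show "y \<in> {y + z |y z. y \<in> F0 \<and> z \<in> (\<Union>w\<in>W k. (\<lambda>x. T w (x - p)) ` C)}"
        using w by blast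
    qed
  qed auto
qed

text \<open>The union is indexed by maps instead of words, so words with the same linear part are
  paid for once. The factor 2 in the radius comes from the Minkowski sum.\<close>

lemma cov_G_by_linear_parts:
  assumes KF: "\<And>r. 0 < r \<Longrightarrow> r \<le> 1 \<Longrightarrow> cov F0 r (KF * r powr (- \<alpha>))"
    and KC: "\<And>r. 0 < r \<Longrightarrow> r \<le> 1 \<Longrightarrow> cov C r (KC * r powr (- \<beta>))"
    and KT: "real (card (T ` W k)) \<le> KT * 2 powr (real k * \<gamma>)" and k: "k \<le> n"
  shows "cov (G k) (2 * 2 powr (- real n))
    (KF * KT * KC * 2 powr (real n * \<alpha> + real k * \<gamma> + (real n - real k) * \<beta>))"
proof -
  let ?r = "2 powr (- (real n - real k))"
  have C: "cov C ?r (KC * ?r powr (- \<beta>))" using k by (intro KC two_powr_le_1) auto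
  have "cov (\<Union>A\<in>T ` W k. (\<lambda>x. A (x - p)) ` C) (2 powr (- real n))
      ((KT * 2 powr (real k * \<gamma>)) * (KC * ?r powr (- \<beta>)))"
  proof (rule cov_UN_const[OF _ _ KT])
    show "finite (T ` W k)" using finite_W by simp
    fix A assume "A \<in> T ` W k"
    then obtain w where w: "w \<in> W k" "A = T w" by blast
    have "cov ((\<lambda>x. T w (x - p)) ` C) (cw w * ?r) (KC * ?r powr (- \<beta>))"
      using C W_D(1)[OF w(1)] cw_pos
      by (intro cov_lipschitz_image) (auto simp: dist_T_diff less_imp_le)
    thus "cov ((\<lambda>x. A (x - p)) ` C) (2 powr (- real n)) (KC * ?r powr (- \<beta>))"
      unfolding w(2) using cw_scale_le[OF w(1)] by (elim cov_mono) auto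
  qed (rule cov_nonneg[OF C])
  hence "cov (\<Union>w\<in>W k. (\<lambda>x. T w (x - p)) ` C) (2 powr (- real n))
      ((KT * 2 powr (real k * \<gamma>)) * (KC * ?r powr (- \<beta>)))" by simp
  from cov_G_of_differences[OF KF this, of n] show ?thesis
    unfolding two_powr_uminus_powr powr_add mult_2 by (simp only: mult_ac)
qed

text \<open>The vectors \<open>T w (q - p)\<close> for words \<open>w\<close> of one ratio lie on a common sphere, whose
  covering number has exponent \<open>d - 1\<close>, and there are few ratios.\<close>

lemma cov_G_by_spheres:
  assumes KF: "\<And>r. 0 < r \<Longrightarrow> r \<le> 1 \<Longrightarrow> cov F0 r (KF * r powr (- \<alpha>))"
    and KC: "\<And>r. 0 < r \<Longrightarrow> r \<le> 1 \<Longrightarrow> cov C r (KC * r powr (- \<beta>))"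
    and KP: "real (card (cw ` W k)) \<le> KP * 2 powr (real k * e)" and k: "k \<le> n"
  shows "cov (G k) (3 * 2 powr (- real n))
    (KF * KP * KC * (2 ^ DIM('a) * real DIM('a) * (2 + D) ^ (DIM('a) - 1)) *
      2 powr (real n * \<alpha> + real k * e + (real n - real k) * (\<beta> + real DIM('a) - 1)))"
proof -
  let ?d = "DIM('a)"
  let ?r = "2 powr (- (real n - real k))"
  let ?m = "2 powr (real n - real k)"
  let ?Ks = "2 ^ ?d * real ?d * ((2 + D) * ?m) ^ (?d - 1)"
  have r1: "?r \<le> 1" using k by (intro two_powr_le_1) auto
  have C: "cov C ?r (KC * ?r powr (- \<beta>))" using r1 by (intro KC) auto
  then obtain Q where Q: "finite Q" "real (card Q) \<le> KC * ?r powr (- \<beta>)" "C \<subseteq> (\<Union>q\<in>Q. cball q ?r)"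
    unfolding cov_def by blast
  \<comment> \<open>A ball of the cover may miss \<open>C\<close> and have a remote centre.
    Discarding such centres bounds the radii of the spheres; those kept are within D + 1 of
    \<open>p\<close>, as \<open>?r \<le> 1\<close>.\<close>
  define Q' where "Q' = {q\<in>Q. dist q p \<le> D + 1}"
  have Q': "finite Q'" "real (card Q') \<le> KC * ?r powr (- \<beta>)"
    using Q(1,2) card_mono[OF Q(1), of Q'] by (auto simp: Q'_def)
  let ?B = "\<Union>\<rho>\<in>cw ` W k. \<Union>q\<in>Q'. sphere (0::'a) (\<rho> * dist q p)"
  have "cov ?B (2 powr (- real n)) ((KP * 2 powr (real k * e)) * ((KC * ?r powr (- \<beta>)) * ?Ks))"
  proof (rule cov_UN_const[OF _ cov_UN_const KP])
    fix \<rho> q assume "\<rho> \<in> cw ` W k" and q: "q \<in> Q'"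
    then obtain w where w: "w \<in> W k" "\<rho> = cw w" by blast
    have \<rho>: "0 \<le> \<rho>" "\<rho> \<le> 2 powr (- real k)" using W_D[OF w(1)] cw_pos w(2) by (auto simp: less_imp_le)
    have "\<rho> * dist q p \<le> 2 powr (- real k) * (D + 1)"
      using \<rho> q D by (intro mult_mono) (auto simp: Q'_def)
    hence "\<rho> * dist q p / 2 powr (- real n) \<le> 2 powr (- real k) * (D + 1) / 2 powr (- real n)"
      by (intro divide_right_mono) auto
    also have "\<dots> = (D + 1) * ?m" by (simp add: powr_minus powr_diff field_simps)
    finally have "1 + \<rho> * dist q p / 2 powr (- real n) \<le> 1 + (D + 1) * ?m" by simp
    also have "\<dots> \<le> (2 + D) * ?m"
      using ge_one_powr_ge_zero[of 2 "real n - real k"] k by (simp add: algebra_simps)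
    finally have "(1 + \<rho> * dist q p / 2 powr (- real n)) ^ (?d - 1) \<le> ((2 + D) * ?m) ^ (?d - 1)"
      using \<rho> by (intro power_mono) auto
    hence "2 ^ ?d * real ?d * (1 + \<rho> * dist q p / 2 powr (- real n)) ^ (?d - 1) \<le> ?Ks"
      by (intro mult_left_mono) auto
    moreover have "cov (sphere (0::'a) (\<rho> * dist q p)) (2 powr (- real n))
        (2 ^ ?d * real ?d * (1 + \<rho> * dist q p / 2 powr (- real n)) ^ (?d - 1))"
      using \<rho> by (intro cov_sphere) auto
    ultimately show "cov (sphere (0::'a) (\<rho> * dist q p)) (2 powr (- real n)) ?Ks"
      by (elim cov_mono) auto
  qed (use finite_W Q' D cov_nonneg[OF C] in auto)
  hence "cov (\<Union>w\<in>W k. (\<lambda>x. T w (x - p)) ` C) (2 powr (- real n) + 2 powr (- real n))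
      ((KP * 2 powr (real k * e)) * ((KC * ?r powr (- \<beta>)) * ?Ks))"
  proof (rule cov_nbhd)
    fix y assume "y \<in> (\<Union>w\<in>W k. (\<lambda>x. T w (x - p)) ` C)"
    then obtain w x where w: "w \<in> W k" "x \<in> C" "y = T w (x - p)" by blast
    obtain q where q: "q \<in> Q" "dist q x \<le> ?r" using Q(3) w(2) by auto
    have "dist q p \<le> D + 1" using dist_triangle[of q p x] q(2) r1 D(2)[OF w(2)] by linarith
    hence "q \<in> Q'" using q(1) by (simp add: Q'_def)
    moreover have "norm (T w (q - p)) = cw w * dist q p"
      using norm_T[OF W_D(1)[OF w(1)]] by (simp add: dist_norm)
    ultimately have "T w (q - p) \<in> ?B" using w(1) by auto
    moreover have "dist y (T w (q - p)) \<le> 2 powr (- real n)"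
    proof -
      have "dist y (T w (q - p)) = cw w * dist q x"
        unfolding w(3) using W_D(1)[OF w(1)] by (simp add: dist_T_diff dist_commute)
      also have "\<dots> \<le> cw w * ?r"
        using q(2) cw_pos[OF W_D(1)[OF w(1)]] by (intro mult_left_mono) auto
      also have "\<dots> \<le> 2 powr (- real n)" by (rule cw_scale_le[OF w(1)])
      finally show ?thesis .
    qed
    ultimately show "\<exists>z\<in>?B. dist y z \<le> 2 powr (- real n)" by blast
  qed
  \<comment> \<open>The radius 3 has one part from the cover of \<open>F0\<close>, one from the
    cover of the spheres, and one from replacing \<open>x\<close> by a centre
    \<open>q\<close>.\<close>
  from cov_G_of_differences[OF KF this, of n]
  have "cov (G k) (3 * 2 powr (- real n))
    (KF * 2 powr (real n * \<alpha>) * ((KP * 2 powr (real k * e)) * ((KC * ?r powr (- \<beta>)) * ?Ks)))"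
    by simp
  also have "KF * 2 powr (real n * \<alpha>) * ((KP * 2 powr (real k * e)) * ((KC * ?r powr (- \<beta>)) * ?Ks))
    = KF * KP * KC * (2 ^ ?d * real ?d * (2 + D) ^ (?d - 1)) *
      (2 powr (real n * \<alpha>) * 2 powr (real k * e) * ?r powr (- \<beta>) * ?m ^ (?d - 1))"
    by (simp add: power_mult_distrib mult_ac)
  also have "?m ^ (?d - 1) = 2 powr ((real n - real k) * (real ?d - 1))"
    by (simp add: powr_powr of_nat_diff flip: powr_realpow)
  also have "2 powr (real n * \<alpha>) * 2 powr (real k * e) * ?r powr (- \<beta>) * 2 powr ((real n - real k) * (real ?d - 1))
    = 2 powr (real n * \<alpha> + real k * e + (real n - real k) * (\<beta> + real ?d - 1))"
    by (simp add: powr_powr algebra_simps flip: powr_add)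
  finally show ?thesis .
qed

end

section \<open>The upper bound\<close>

lemma min_min_cases:
  fixes a b c d :: "'a::linorder"
  shows "min (min a b) (min c d) = a \<or> min (min a b) (min c d) = b \<or>
    min (min a b) (min c d) = c \<or> min (min a b) (min c d) = d"
  by (auto simp: min_def)

lemma ex_dyadic_level:
  assumes "0 < (x::real)" "x \<le> 1"
  shows "\<exists>k::nat. 2 powr (- (real k + 1)) < x \<and> x \<le> 2 powr (- real k)"
proof -
  define k where "k = nat \<lfloor>- log 2 x\<rfloor>"
  have "log 2 x \<le> 0" using assms by simp
  hence k: "real k \<le> - log 2 x" "- log 2 x < real k + 1" unfolding k_def by linarith+
  have "2 powr (- (real k + 1)) < 2 powr (log 2 x)" using k by (intro powr_less_mono) auto
  moreover have "2 powr (log 2 x) \<le> 2 powr (- real k)" using k by (intro powr_mono) auto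
  ultimately show ?thesis using assms by auto
qed

context orbital_set
begin

text \<open>The fixed point equation is unfolded \<open>l\<close> times, stopping early as soon as
  the point is found in an image of \<open>C\<close>.\<close>

lemma inhomogeneous_attractor_words:
  assumes FC: "FC = (\<Union>i\<in>I. (\<lambda>x. c i *\<^sub>R M i x + b i) ` FC) \<union> C" and x: "x \<in> FC"
  shows "(\<exists>w. set w \<subseteq> I \<and> x \<in> S w ` C) \<or> (\<exists>w. set w \<subseteq> I \<and> length w = l \<and> x \<in> S w ` FC)"
proof (induction l)
  case 0
  show ?case using x by (intro disjI2 exI[of _ "[]"]) auto
next
  case (Suc l)
  show ?case
  proof (cases "\<exists>w. set w \<subseteq> I \<and> x \<in> S w ` C")
    case False
    then obtain w y where w: "set w \<subseteq> I" "length w = l" "y \<in> FC" "x = S w y" using Suc.IH by blast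
    have "y \<notin> C" using w False by blast
    with w(3) have "y \<in> (\<Union>i\<in>I. (\<lambda>x. c i *\<^sub>R M i x + b i) ` FC)" using FC by blast
    then obtain i z where "i \<in> I" "z \<in> FC" "y = S [i] z" by auto
    thus ?thesis using w by (intro disjI2 exI[of _ "w @ [i]"]) (auto intro!: image_eqI[of _ _ z])
  qed blast
qed

lemma inhomogeneous_attractor_subset:
  assumes FC: "FC = (\<Union>i\<in>I. (\<lambda>x. c i *\<^sub>R M i x + b i) ` FC) \<union> C"
    and DFC: "\<And>x. x \<in> FC \<Longrightarrow> dist x p \<le> D" and x: "x \<in> FC"
  shows "x \<in> (\<Union>k\<le>n. G k) \<or> (\<exists>y\<in>F0. dist x y \<le> D * 2 powr (- real n))"
proof -
  have near: "\<exists>y\<in>F0. dist x y \<le> D * 2 powr (- real n)"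
    if w: "set w \<subseteq> I" "cw w \<le> 2 powr (- real n)" "x \<in> S w ` FC" for w
  proof -
    obtain z where z: "z \<in> FC" "x = S w z" using w(3) by blast
    have "dist x (S w p) = cw w * dist z p" using z w(1) by (simp add: dist_S)
    also have "\<dots> \<le> 2 powr (- real n) * D" using w DFC[OF z(1)] by (intro mult_mono) auto
    finally show ?thesis using S_F0[OF w(1) p] by (auto simp: mult.commute)
  qed
  obtain l where l: "cmax ^ l < 2 powr (- real n)"
    using real_arch_pow_inv[of "2 powr (- real n)" cmax] cmax by auto
  from inhomogeneous_attractor_words[OF FC x, of l] show ?thesis
  proof (elim disjE exE conjE)
    fix w assume w: "set w \<subseteq> I" "x \<in> S w ` C"
    have "cw w \<le> 1" using cw_le[OF w(1)] power_le_one[of cmax "length w"] cmax by linarith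
    then obtain k where k: "2 powr (- (real k + 1)) < cw w" "cw w \<le> 2 powr (- real k)"
      using ex_dyadic_level cw_pos[OF w(1)] by blast
    show ?thesis
    proof (cases "k \<le> n")
      case True
      have "x \<in> G k" using w k unfolding G_def W_def by blast
      thus ?thesis using True by blast
    next
      case False
      hence "2 powr (- real k) \<le> 2 powr (- real n)" by (intro powr_mono) auto
      with k(2) have "cw w \<le> 2 powr (- real n)" by linarith
      moreover have "C \<subseteq> FC" using FC by blast
      ultimately show ?thesis using near[OF w(1)] w(2) by blast
    qed
  next
    fix w assume w: "set w \<subseteq> I" "length w = l" "x \<in> S w ` FC"
    have "cw w \<le> 2 powr (- real n)" using cw_le[OF w(1)] l w(2) by simp
    thus ?thesis using near w by blast
  qed
qed

end

context self_similar_set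
begin

theorem upper_box_dim_inhomogeneous_le:
  fixes C FC :: "'a set" and \<beta> \<gamma> :: real
  assumes "compact C" "C \<noteq> {}" "compact FC" "FC \<noteq> {}"
    and FC: "FC = (\<Union>i\<in>I. (\<lambda>x. c i *\<^sub>R M i x + b i) ` FC) \<union> C"
    and \<alpha>: "\<alpha> = hausdorff_dim F0" and \<beta>: "upper_box_dim C = ereal \<beta>" and \<gamma>: "0 \<le> \<gamma>"
    and lim: "limsup (\<lambda>k. ereal (real (card (T ` words_k I c k)) powr (1 / real k))) = ereal (2 powr \<gamma>)"
  shows "upper_box_dim FC \<le> ereal (SUP x\<in>{0..1::real}.
           min (min (x * s + (1 - x) * \<beta>) (x * \<alpha> + (1 - x) * real DIM('a)))
               (min (\<alpha> + (1 - x) * (\<beta> + real DIM('a) - 1)) (\<alpha> + x * \<gamma> + (1 - x) * \<beta>)))"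
    (is "_ \<le> ereal (SUP x\<in>_. ?f x)")
proof -
  let ?d = "DIM('a)"
  define \<tau> where "\<tau> = (SUP x\<in>{0..1::real}. ?f x)"
  have \<alpha>0: "0 \<le> \<alpha>" and \<alpha>s: "\<alpha> \<le> s"
    using hausdorff_dim_nonneg[OF ex_hausdorff_measure_F0_eq_0] hausdorff_dim_F0_le \<alpha> by auto
  have bdC: "bounded C" and bdFC: "bounded FC"
    using assms compact_imp_bounded by blast+
  have \<tau>: "?f x \<le> \<tau>" if "0 \<le> x" "x \<le> 1" for x
    unfolding \<tau>_def
  proof (rule cSUP_upper)
    \<comment> \<open>Without an upper bound the real supremum would say nothing. The first of the
      four terms provides one.\<close>
    show "bdd_above (?f ` {0..1})"
    proof (rule bdd_aboveI2)
      fix x :: real assume x: "x \<in> {0..1}"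
      have "x * s \<le> 1 * s" using x s by (intro mult_right_mono) auto
      moreover have "(1 - x) * \<beta> \<le> (1 - x) * \<bar>\<beta>\<bar>" using x by (intro mult_left_mono) auto
      moreover have "(1 - x) * \<bar>\<beta>\<bar> \<le> 1 * \<bar>\<beta>\<bar>" using x by (intro mult_right_mono) auto
      ultimately show "?f x \<le> s + \<bar>\<beta>\<bar>" by linarith
    qed
  qed (use that in auto)
  \<comment> \<open>At x = 1 the minimum is \<alpha>, so the supremum also pays for the points near
    \<open>F0\<close> that belong to no level up to n.\<close>
  have \<alpha>\<tau>: "\<alpha> \<le> \<tau>" using \<tau>[of 1] \<alpha>s \<gamma> by (simp add: min_def split: if_splits)
  obtain p where p: "p \<in> F0" using F0_nonempty by blast
  obtain D where D: "0 < D" "FC \<subseteq> ball p D" using bounded_subset_ballD[OF bdFC] by blast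
  have DFC: "dist x p \<le> D" if "x \<in> FC" for x
    using D(2) that by (auto simp: dist_commute less_imp_le)
  interpret orbital_set I c M b F0 s C p D
    using p D(1) DFC FC by unfold_locales auto
  have main: "upper_box_dim FC \<le> ereal \<tau> + ereal (3 * e)" if e: "0 < e" for e
  proof -
    obtain KF where KF: "0 < KF" "\<And>r. 0 < r \<Longrightarrow> r \<le> 1 \<Longrightarrow> cov F0 r (KF * r powr (- (\<alpha> + e)))"
      using cov_F0[of "\<alpha> + e"] \<alpha> e by auto
    obtain KC where KC: "0 < KC" "\<And>r. 0 < r \<Longrightarrow> r \<le> 1 \<Longrightarrow> cov C r (KC * r powr (- (\<beta> + e)))"
      using cov_of_upper_box_dim[OF bdC assms(2), of "\<beta> + e"] \<beta> e by auto
    obtain Kw where Kw: "0 < Kw" "\<And>k. real (card (W k)) \<le> Kw * 2 powr (real k * (s + e))"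
      using card_W_le[OF s e] by blast
    obtain KP where KP: "0 < KP" "\<And>k. real (card (cw ` W k)) \<le> KP * 2 powr (real k * e)"
      using card_ratios_le[OF e] by blast
    obtain KT where KT: "0 < KT" "\<And>k. real (card (T ` W k)) \<le> KT * 2 powr (real k * (\<gamma> + e))"
      using card_T_le[OF \<gamma> lim e] by blast
    obtain KL where KL: "0 < KL" "\<And>n::nat. real n + 1 \<le> KL * 2 powr (real n * e)"
      using linear_le_powr[OF e] by blast
    define K1 where "K1 = Kw * KC"
    define K2 where "K2 = KF * (3 + 2 * D) ^ ?d"
    define K3 where "K3 = KF * KP * KC * (2 ^ ?d * real ?d * (2 + D) ^ (?d - 1))"
    define K4 where "K4 = KF * KT * KC"
    have K: "0 < K1" "0 < K2" "0 < K3" "0 < K4"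
      using KF(1) KC(1) Kw(1) KP(1) KT(1) D(1) by (auto simp: K1_def K2_def K3_def K4_def)
    define K where "K = K1 + K2 + K3 + K4"
    have level: "cov (G k) (3 * 2 powr (- real n)) (K * 2 powr (real n * (\<tau> + 2 * e)))"
      if n: "1 \<le> n" and k: "k \<le> n" for n k
    proof -
      \<comment> \<open>The level relative to the scale; \<open>n \<ge> 1\<close> makes the quotient
        meaningful and \<open>k \<le> n\<close> puts it into [0, 1].\<close>
      define x where "x = real k / real n"
      have x: "0 \<le> x" "x \<le> 1" using n k by (auto simp: x_def)
      have kx: "real k = real n * x" using n by (simp add: x_def)
      have xn: "0 \<le> real n * e" "0 \<le> real n * e * x" using e x by auto
      have *: "cov (G k) (3 * 2 powr (- real n)) (K * 2 powr (real n * (\<tau> + 2 * e)))"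
        if "cov (G k) r (K' * 2 powr E)" "r \<le> 3 * 2 powr (- real n)" "K' \<le> K"
          "E \<le> real n * (t + 2 * e)" "t \<le> \<tau>" for r K' E t
      proof (rule cov_mono[OF that(1) _ that(2)])
        have "real n * (t + 2 * e) \<le> real n * (\<tau> + 2 * e)" using that(5) by (intro mult_left_mono) auto
        hence "2 powr E \<le> 2 powr (real n * (\<tau> + 2 * e))" using that(4) by (intro powr_mono) auto
        thus "K' * 2 powr E \<le> K * 2 powr (real n * (\<tau> + 2 * e))"
          using that(3) K by (intro mult_mono) (auto simp: K_def)
      qed simp
      consider "?f x = x * s + (1 - x) * \<beta>" | "?f x = x * \<alpha> + (1 - x) * real ?d"
        | "?f x = \<alpha> + (1 - x) * (\<beta> + real ?d - 1)" | "?f x = \<alpha> + x * \<gamma> + (1 - x) * \<beta>"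
        using min_min_cases[of "x * s + (1 - x) * \<beta>" "x * \<alpha> + (1 - x) * real ?d"
          "\<alpha> + (1 - x) * (\<beta> + real ?d - 1)" "\<alpha> + x * \<gamma> + (1 - x) * \<beta>"] by argo
      thus ?thesis
      proof cases
        case 1
        show ?thesis
        proof (rule *[where t = "?f x", OF cov_G_by_words[OF KC(2) Kw(2) k] _ _ _ \<tau>[OF x]])
          show "real k * (s + e) + (real n - real k) * (\<beta> + e) \<le> real n * (?f x + 2 * e)"
            unfolding 1 kx using xn by (simp add: algebra_simps)
        qed (use K in \<open>auto simp: K_def K1_def\<close>)
      next
        case 2
        show ?thesis
        proof (rule *[where t = "?f x", OF cov_G_by_neighbourhood[OF KF(2) k] _ _ _ \<tau>[OF x]])
          have "real n * e * x \<le> real n * e * 1" using xn x by (intro mult_left_mono) auto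
          thus "real k * (\<alpha> + e) + (real n - real k) * real ?d \<le> real n * (?f x + 2 * e)"
            unfolding 2 kx using xn by (simp add: algebra_simps)
        qed (use K in \<open>auto simp: K_def K2_def\<close>)
      next
        case 3
        show ?thesis
        proof (rule *[where t = "?f x", OF cov_G_by_spheres[OF KF(2) KC(2) KP(2) k] _ _ _ \<tau>[OF x]])
          show "real n * (\<alpha> + e) + real k * e + (real n - real k) * (\<beta> + e + real ?d - 1)
              \<le> real n * (?f x + 2 * e)"
            unfolding 3 kx using xn by (simp add: algebra_simps)
        qed (use K in \<open>auto simp: K_def K3_def\<close>)
      next
        case 4
        show ?thesis
        proof (rule *[where t = "?f x", OF cov_G_by_linear_parts[OF KF(2) KC(2) KT(2) k] _ _ _ \<tau>[OF x]])
          show "real n * (\<alpha> + e) + real k * (\<gamma> + e) + (real n - real k) * (\<beta> + e)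
              \<le> real n * (?f x + 2 * e)"
            unfolding 4 kx using xn by (simp add: algebra_simps)
        qed (use K in \<open>auto simp: K_def K4_def\<close>)
      qed
    qed
    define K' where "K' = KL * K + KF"
    \<comment> \<open>3 + \<open>D\<close> exceeds both radius factors that occur, 3 for the levels
      and 1 + \<open>D\<close> for the neighbourhood of \<open>F0\<close>.\<close>
    define L where "L = 3 + D"
    have "cov FC (2 powr (- real n)) (K' * (1 + 2 * L) ^ ?d * 2 powr (real n * (\<tau> + 3 * e)))"
      if n: "1 \<le> n" for n
    proof -
      let ?u = "2 powr (- real n)"
      let ?E = "2 powr (real n * (\<tau> + 3 * e))"
      \<comment> \<open>The n + 1 levels are paid for by \<open>KL * 2 powr (real n * e)\<close>,
        which is the third e.\<close>
      have "cov (\<Union>k\<le>n. G k) (3 * ?u) ((KL * 2 powr (real n * e)) * (K * 2 powr (real n * (\<tau> + 2 * e))))"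
        using level[OF n] KL(2)[of n] K by (intro cov_UN_const) (auto simp: K_def add.commute)
      hence U: "cov (\<Union>k\<le>n. G k) (L * ?u) ((KL * 2 powr (real n * e)) * (K * 2 powr (real n * (\<tau> + 2 * e))))"
        using D(1) by (elim cov_mono) (auto simp: L_def intro: mult_right_mono)
      have eqE: "(KL * 2 powr (real n * e)) * (K * 2 powr (real n * (\<tau> + 2 * e))) = KL * K * ?E"
        by (simp add: algebra_simps flip: powr_add)
      let ?Nb = "{x. \<exists>y\<in>F0. dist x y \<le> D * ?u}"
      have "cov F0 ?u (KF * ?u powr (- (\<alpha> + e)))" by (intro KF two_powr_le_1) auto
      hence "cov ?Nb (?u + D * ?u) (KF * 2 powr (real n * (\<alpha> + e)))"
        unfolding two_powr_uminus_powr by (rule cov_nbhd) auto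
      moreover have "KF * 2 powr (real n * (\<alpha> + e)) \<le> KF * ?E" using KF(1) \<alpha>\<tau> e by (intro mult_left_mono powr_mono) auto
      moreover have "?u + D * ?u \<le> L * ?u" by (simp add: L_def algebra_simps)
      ultimately have N: "cov ?Nb (L * ?u) (KF * ?E)" by (elim cov_mono) auto
      have "FC \<subseteq> (\<Union>k\<le>n. G k) \<union> ?Nb" using inhomogeneous_attractor_subset[OF FC DFC, of _ n] by blast
      hence "cov FC (L * ?u) (KL * K * ?E + KF * ?E)"
        using cov_Un[OF U[unfolded eqE] N] by (elim cov_mono) auto
      hence "cov FC ?u ((KL * K * ?E + KF * ?E) * (1 + 2 * L) ^ ?d)"
        using D(1) by (intro cov_rescale) (auto simp: L_def)
      thus ?thesis by (simp add: K'_def algebra_simps)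
    qed
    hence "upper_box_dim FC \<le> ereal (\<tau> + 3 * e)"
      using \<alpha>0 \<alpha>\<tau> e by (intro upper_box_dim_le_of_cov[OF bdFC assms(4)]) auto
    thus ?thesis by simp
  qed
  have "upper_box_dim FC \<le> ereal \<tau> + ereal e" if "0 < e" for e
    using main[of "e / 3"] that by simp
  hence "upper_box_dim FC \<le> ereal \<tau>" by (rule ereal_le_epsilon2)
  thus ?thesis unfolding \<tau>_def .
qed

end

text \<open>The supremum is attained: a minimum of four affine functions of x is continuous on the
  compact interval [0, 1].\<close>

theorem theorem4p8:
  fixes I :: "'i set" and c :: "'i \<Rightarrow> real"
    and M :: "'i \<Rightarrow> 'a::euclidean_space \<Rightarrow> 'a" and b :: "'i \<Rightarrow> 'a"
    and C FC F0 :: "'a set" and s \<alpha> \<beta> \<gamma> :: real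
  assumes "finite I" and "I \<noteq> {}"
    and "\<forall>i\<in>I. 0 < c i \<and> c i < 1"
    and "\<forall>i\<in>I. orthogonal_transformation (M i)"
    and "compact C" and "C \<noteq> {}"
    and "compact FC" and "FC \<noteq> {}"
    and "FC = (\<Union>i\<in>I. (\<lambda>x. c i *\<^sub>R M i x + b i) ` FC) \<union> C"
    and "compact F0" and "F0 \<noteq> {}"
    and "F0 = (\<Union>i\<in>I. (\<lambda>x. c i *\<^sub>R M i x + b i) ` F0)"
    and "0 \<le> s" and "(\<Sum>i\<in>I. c i powr s) = 1"
    and "\<alpha> = hausdorff_dim F0"
    and "upper_box_dim C = ereal \<beta>"
    and "0 \<le> \<gamma>"
    and "limsup (\<lambda>k. ereal (real (card ((\<lambda>w. word_comp (\<lambda>i x. c i *\<^sub>R M i x) w) ` words_k I c k))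
                 powr (1 / real k))) = ereal (2 powr \<gamma>)"
  shows "upper_box_dim FC \<le> ereal (SUP x\<in>{0..1::real}.
           min (min (x * s + (1 - x) * \<beta>) (x * \<alpha> + (1 - x) * real DIM('a)))
               (min (\<alpha> + (1 - x) * (\<beta> + real DIM('a) - 1)) (\<alpha> + x * \<gamma> + (1 - x) * \<beta>)))"
proof -
  interpret self_similar_set I c M b F0 s
    by unfold_locales (use assms(1-4,10-14) in auto)
  have "(\<lambda>w. word_comp (\<lambda>i x. c i *\<^sub>R M i x) w) = T" by (simp add: T_def)
  hence lim: "limsup (\<lambda>k. ereal (real (card (T ` words_k I c k)) powr (1 / real k))) = ereal (2 powr \<gamma>)"
    using assms(18) by simp
  show ?thesis
    by (rule upper_box_dim_inhomogeneous_le[OF assms(5-9) assms(15-17) lim])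
qed

end
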